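(* Let $0<\lambda<1$ and $F:\mathbb{C}^2\to\mathbb{C}^2$, $F(z,w)=(\lambda z-z^2,\ w-w^2-z^2)$, and let $\Omega$ be the attracting basin of $F$ at $(0,0)$. Then for every sufficiently small $\epsilon>0$ the following holds. Let $S=\bigcup_{k\ge 0}F^{-k}(\{(\epsilon,\epsilon)\})$ be the set of preimages of $(\epsilon,\epsilon)$ under $F$. For any connected component $\Omega_\alpha$ of $\Omega$, set $S_\alpha:=S\cap\Omega_\alpha$. Then for every constant $C>0$ there exists a point $p_\alpha\in\Omega_\alpha$ such that for every $q\in S_\alpha$ the Kobayashi distance satisfies $d_{\Omega_\alpha}(p_\alpha,q)\ge C$.
   Context: The attracting basin $\Omega$ of $F$ at $(0,0)$ is the set of points of $\mathbb{C}^2$ having an open neighborhood on which the iterates $F^n$ converge uniformly to the constant $(0,0)$; it is an open set. $d_{\Omega_\alpha}$ denotes the Kobayashi (pseudo)distance of the domain $\Omega_\alpha$. *)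

theory Defs
  imports "HOL-Complex_Analysis.Complex_Analysis"
begin

definition attracting_basin :: "('a::metric_space \<Rightarrow> 'a) \<Rightarrow> 'a \<Rightarrow> 'a set" where
  "attracting_basin F c =
     {x. \<exists>U. open U \<and> x \<in> U \<and> uniform_limit U (\<lambda>n. F ^^ n) (\<lambda>_. c) sequentially}"

text \<open>The Poincare distance of the unit disc, normalised as the integrated form of
  \<open>|dz| / (1 - |z|^2)\<close>; \<open>Moebius_function 0 a b\<close> is \<open>(b - a) / (1 - cnj a * b)\<close>.\<close>

definition poincare_dist :: "complex \<Rightarrow> complex \<Rightarrow> real" where
  "poincare_dist a b = artanh (cmod (Moebius_function 0 a b))"

definition holomorphic_discs :: "(complex \<times> complex) set \<Rightarrow> (complex \<Rightarrow> complex \<times> complex) set" where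
  "holomorphic_discs X =
     {f. (\<lambda>t. fst (f t)) holomorphic_on ball 0 1 \<and> (\<lambda>t. snd (f t)) holomorphic_on ball 0 1 \<and>
         f ` ball 0 1 \<subseteq> X}"

text \<open>Kobayashi's definition: the infimum of the lengths of chains of holomorphic discs in \<open>X\<close>
  joining \<open>x\<close> to \<open>y\<close>.  The value is \<open>\<infinity>\<close> if there is no such chain; when \<open>X\<close> is open and connected
  and contains \<open>x\<close> and \<open>y\<close> it is finite.\<close>

definition kobayashi_dist ::
    "(complex \<times> complex) set \<Rightarrow> complex \<times> complex \<Rightarrow> complex \<times> complex \<Rightarrow> ereal" where
  "kobayashi_dist X x y =
     Inf {ereal (\<Sum>i<n. poincare_dist (a i) (b i)) | n f a b p.
            0 < n \<and> p 0 = x \<and> p n = y \<and>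
            (\<forall>i<n. f i \<in> holomorphic_discs X \<and> a i \<in> ball 0 1 \<and> b i \<in> ball 0 1 \<and>
                   f i (a i) = p i \<and> f i (b i) = p (Suc i))}"

definition F_map :: "real \<Rightarrow> complex \<times> complex \<Rightarrow> complex \<times> complex" where
  "F_map l = (\<lambda>(z, w). (complex_of_real l * z - z\<^sup>2, w - w\<^sup>2 - z\<^sup>2))"

definition iterated_preimages :: "('a \<Rightarrow> 'a) \<Rightarrow> 'a \<Rightarrow> 'a set" where
  "iterated_preimages F x = (\<Union>k. (F ^^ k) -` {x})"

end

theory Submission
  imports Defs
begin

text \<open>
  Write \<open>\<Omega>\<close> for the basin, \<open>q0 = (\<epsilon>, \<epsilon>)\<close>, and \<open>P z = l z - z\<^sup>2\<close> for the first
  coordinate of \<open>F\<close>.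

  \<^bold>\<open>Reduction to one orbit.\<close>  Let \<open>j\<close> be the least number of steps in which \<open>F\<close> takes some point of
  the component \<open>\<Omega>\<^sub>\<alpha>\<close> to \<open>q0\<close>.  As \<open>F\<close> is open, \<open>F\<^sup>j\<close> maps \<open>\<Omega>\<^sub>\<alpha>\<close> \<^emph>\<open>onto\<close> a component of \<open>\<Omega>\<close>
  (\<open>component_image_eq_component\<close>), and that component contains the whole orbit of \<open>q0\<close>, because
  the segment from \<open>q0\<close> to \<open>F q0\<close> lies in \<open>\<Omega>\<close> (\<open>segment_in_basin\<close>).  So some \<open>p\<close> in \<open>\<Omega>\<^sub>\<alpha>\<close>
  satisfies \<open>F\<^sup>j p = F\<^sup>N q0\<close>.  If \<open>F\<^sup>k q = q0\<close> with \<open>q\<close> in \<open>\<Omega>\<^sub>\<alpha>\<close>, then \<open>k \<ge> j\<close>, and since \<open>F\<^sup>k\<close>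
  does not increase Kobayashi distances, the distance from \<open>p\<close> to \<open>q\<close> is at least the distance in
  \<open>\<Omega>\<close> from \<open>F\<^sup>n q0\<close> to \<open>q0\<close>, where \<open>n = k - j + N \<ge> N\<close>.  It remains to see that this distance tends
  to infinity with \<open>n\<close> (\<open>kobayashi_dist_orbit_unbounded\<close>).

  \<^bold>\<open>Divergence along the orbit.\<close>  By Harnack's inequality, if \<open>u\<close> is holomorphic with
  \<open>0 < |u| < 1\<close>, then \<open>- ln |u|\<close> grows at most by the factor \<open>exp (2 \<delta>)\<close> along a disc segment of
  Poincare length \<open>\<delta>\<close>.  A zero-free \<open>u\<close> on \<open>\<Omega>\<close> that tends to \<open>0\<close> along the orbit would therefore
  finish the proof.  The fixed point has a strong stable manifold \<open>w = h z\<close>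
  (\<open>strong_stable_manifold\<close>).  It misses \<open>\<Omega>\<close>, because along its orbits the derivative of the second
  coordinate of \<open>F\<^sup>n\<close> with respect to \<open>w\<close> stays away from \<open>0\<close>
  (\<open>basin_avoids_strong_stable_manifold\<close>).  So \<open>u = w - h z\<close> has the required properties, but it is
  defined for small \<open>|z|\<close> only.

  This is repaired by pushing chains forward.  Harnack's inequality for \<open>z - \<xi>\<close>, with \<open>\<xi>\<close> outside
  the basin of \<open>P\<close>, shows that chains of length at most \<open>C\<close> that end in \<open>q0\<close> have their first
  coordinates in a compact part of the basin of \<open>P\<close> (\<open>short_chain_stays_in_compact\<close>).  Hence one
  iterate \<open>F\<^sup>m\<close>, with \<open>m\<close> depending on \<open>C\<close> but not on the chain, moves all of them to where \<open>h\<close> is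
  defined.  The discs of a chain may leave that region far from the two marked points; for this
  reason they are cut down to pseudohyperbolic discs of a radius \<open>r\<close> with \<open>tanh C < r < 1\<close>, which
  only worsens the constant in the exponent.
\<close>


section \<open>Harnack's inequality and the Poincare distance\<close>

text \<open>Harnack's inequality for the positive harmonic function \<open>- ln |g|\<close>.  A logarithm \<open>k\<close> of \<open>g\<close> maps
  the disc into the left half plane; the Cayley transform that sends \<open>k 0\<close> to \<open>0\<close> turns \<open>k\<close> into a
  self-map of the disc, to which the Schwarz lemma applies.\<close>
lemma harnack_zero_free:
  fixes g :: "complex \<Rightarrow> complex"
  assumes hol: "g holomorphic_on ball 0 1"
    and bd: "\<And>z. z \<in> ball 0 1 \<Longrightarrow> g z \<noteq> 0 \<and> norm (g z) < 1"
    and z: "norm z < 1"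
  shows "- ln (norm (g z)) \<le> (1 + norm z) / (1 - norm z) * - ln (norm (g 0))"
proof -
  obtain k where k: "k holomorphic_on ball 0 1" "\<And>z. z \<in> ball 0 1 \<Longrightarrow> g z = exp (k z)"
    using contractible_imp_holomorphic_log[OF hol, of] convex_imp_contractible[OF convex_ball] bd
    by metis
  have ln_g: "ln (norm (g x)) = Re (k x)" if "x \<in> ball 0 1" for x
    using k(2)[OF that] by simp
  have Re_neg: "Re (k x) < 0" if "x \<in> ball 0 1" for x
    using bd[OF that] k(2)[OF that] by simp
  define c where "c = k 0"
  have c: "Re c < 0" using Re_neg[of 0] by (simp add: c_def)
  define \<phi> where "\<phi> = (\<lambda>x. (k x - c) / (k x + cnj c))"
  have nz: "k x + cnj c \<noteq> 0" if "x \<in> ball 0 1" for x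
  proof
    assume "k x + cnj c = 0"
    then have "Re (k x + cnj c) = 0" by (simp only: zero_complex.sel)
    then have "Re (k x) + Re c = 0" by simp
    then show False using Re_neg[OF that] c by linarith
  qed
  \<comment> \<open>The Cayley transform \<open>\<phi>\<close> maps the half plane \<open>Re < 0\<close> into the disc, as this identity shows.\<close>
  have sq: "norm (k x - c) ^ 2 - norm (k x + cnj c) ^ 2 = - 4 * Re (k x) * Re c" for x
    unfolding cmod_power2 by (simp add: power2_eq_square algebra_simps)
  have "norm (\<phi> z) \<le> norm z"
  proof (rule Schwarz_Lemma(1))
    show "\<phi> holomorphic_on ball 0 1"
      unfolding \<phi>_def using nz by (intro holomorphic_intros k) auto
    show "\<phi> 0 = 0" by (simp add: \<phi>_def c_def)
    show "norm (\<phi> x) < 1" if "norm x < 1" for x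
    proof -
      have x: "x \<in> ball 0 1" using that by simp
      have "Re (k x) * Re c > 0" using Re_neg[OF x] c by (rule mult_neg_neg)
      then have "norm (k x - c) ^ 2 < norm (k x + cnj c) ^ 2" using sq[of x] by linarith
      then have "norm (k x - c) < norm (k x + cnj c)" using power2_less_imp_less by force
      then show ?thesis using nz[OF x] by (simp add: \<phi>_def norm_divide)
    qed
  qed (use z in auto)
  then have le: "norm (k z - c) \<le> norm z * norm (k z + cnj c)"
    using nz[of z] z by (simp add: \<phi>_def norm_divide divide_simps)
  define t where "t = norm z"
  have t: "0 \<le> t" "t < 1" using z by (auto simp: t_def)
  define A where "A = - Re (k z)"
  define A0 where "A0 = - Re c"
  define y where "y = Im (k z) - Im c"
  have pos: "A > 0" "A0 > 0" using Re_neg[of z] z c by (auto simp: A_def A0_def)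
  have "norm (k z - c) ^ 2 \<le> (t * norm (k z + cnj c)) ^ 2"
    using le unfolding t_def by (intro power_mono) auto
  then have "(A - A0)\<^sup>2 + y\<^sup>2 \<le> t\<^sup>2 * ((A + A0)\<^sup>2 + y\<^sup>2)"
    unfolding power_mult_distrib cmod_power2
    by (simp add: A_def A0_def y_def power2_eq_square algebra_simps)
  moreover have "t\<^sup>2 * y\<^sup>2 \<le> 1 * y\<^sup>2"
    using t by (intro mult_right_mono) (auto simp: power_le_one)
  ultimately have "(A - A0)\<^sup>2 \<le> t\<^sup>2 * (A + A0)\<^sup>2"
    unfolding distrib_left by linarith
  then have "(A - A0)\<^sup>2 \<le> (t * (A + A0))\<^sup>2" by (simp add: power_mult_distrib)
  then have "A - A0 \<le> t * (A + A0)"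
    by (rule power2_le_imp_le) (use t pos in auto)
  then have "A * (1 - t) \<le> (1 + t) * A0" by (simp add: algebra_simps)
  then have "A \<le> (1 + t) / (1 - t) * A0" using t by (simp add: field_simps)
  then show ?thesis using ln_g[of z] ln_g[of 0] z by (simp add: A_def A0_def t_def c_def)
qed

definition pseudohyperbolic_disc :: "complex \<Rightarrow> real \<Rightarrow> complex set" where
  "pseudohyperbolic_disc b r = {\<zeta> \<in> ball 0 1. norm (Moebius_function 0 b \<zeta>) < r}"

text \<open>The previous inequality transported by the Moebius map with centre \<open>b\<close> and rescaled to radius \<open>r\<close>.
  The freedom to take \<open>r < 1\<close> serves for functions \<open>g\<close> that are defined near \<open>b\<close> only.\<close>
lemma harnack_pseudohyperbolic_disc:
  fixes g :: "complex \<Rightarrow> complex"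
  assumes b: "b \<in> ball 0 1" and r: "0 < r" "r \<le> 1"
    and hol: "g holomorphic_on pseudohyperbolic_disc b r"
    and bd: "\<And>\<zeta>. \<zeta> \<in> pseudohyperbolic_disc b r \<Longrightarrow> g \<zeta> \<noteq> 0 \<and> norm (g \<zeta>) < 1"
    and a: "a \<in> pseudohyperbolic_disc b r"
  defines "t \<equiv> norm (Moebius_function 0 b a)"
  shows "- ln (norm (g a)) \<le> (r + t) / (r - t) * - ln (norm (g b))"
proof -
  let ?M = "Moebius_function 0 (- b)"
  have b1: "norm b < 1" using b by simp
  have a1: "norm a < 1" and tr: "t < r" using a by (auto simp: pseudohyperbolic_disc_def t_def)
  have rx: "norm (of_real r * x) < r" "norm (of_real r * x) < 1" if "norm x < 1" for x :: complex
  proof -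
    have "r * norm x < r * 1" using that r by (intro mult_strict_left_mono) auto
    then show "norm (of_real r * x) < r" using r by (simp add: norm_mult)
    then show "norm (of_real r * x) < 1" using r by linarith
  qed
  have M1: "norm (?M x) < 1" if "norm x < 1" for x
    using Moebius_function_norm_lt_1[of "-b" x 0] b1 that by simp
  have M2: "Moebius_function 0 b (?M x) = x" if "norm x < 1" for x
    using Moebius_function_compose[of b "-b" x] b1 that by simp
  have M3: "?M (Moebius_function 0 b a) = a"
    using Moebius_function_compose[of "-b" b a] b1 a1 by simp
  have into: "?M (of_real r * x) \<in> pseudohyperbolic_disc b r" if "norm x < 1" for x
    using M1[OF rx(2)[OF that]] M2[OF rx(2)[OF that]] rx(1)[OF that]
    by (simp add: pseudohyperbolic_disc_def)
  define G where "G = g \<circ> (\<lambda>x. ?M (of_real r * x))"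
  define x where "x = Moebius_function 0 b a / of_real r"
  have nx: "norm x = t / r" using r by (simp add: x_def t_def norm_divide)
  have Mhol: "(\<lambda>x. ?M (of_real r * x)) holomorphic_on ball 0 1"
  proof -
    have "(?M \<circ> (\<lambda>x. of_real r * x)) holomorphic_on ball 0 1"
      by (rule holomorphic_on_compose_gen[of _ _ _ "ball 0 1"])
         (use rx b1 in \<open>auto intro!: holomorphic_intros Moebius_function_holomorphic\<close>)
    then show ?thesis by (simp add: o_def)
  qed
  have "- ln (norm (G x)) \<le> (1 + norm x) / (1 - norm x) * - ln (norm (G 0))"
  proof (rule harnack_zero_free)
    show "G holomorphic_on ball 0 1"
      unfolding G_def
      by (rule holomorphic_on_compose_gen[OF Mhol hol]) (use into in auto)
    show "G y \<noteq> 0 \<and> norm (G y) < 1" if "y \<in> ball 0 1" for y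
      using bd[OF into[of y]] that by (simp add: G_def)
    show "norm x < 1" using nx tr r by simp
  qed
  moreover have "G x = g a" using r M3 by (simp add: G_def x_def)
  moreover have "G 0 = g b" by (simp add: G_def Moebius_function_of_zero)
  moreover have "(1 + norm x) / (1 - norm x) = (r + t) / (r - t)"
    using r tr by (simp add: nx divide_simps)
  ultimately show ?thesis by simp
qed

lemma norm_Moebius_commute: "norm (Moebius_function 0 a b) = norm (Moebius_function 0 b a)"
proof -
  have "norm (1 - cnj a * b) = norm (1 - a * cnj b)"
    by (metis complex_cnj_cnj complex_cnj_diff complex_cnj_mult complex_cnj_one complex_mod_cnj)
  then show ?thesis by (simp add: Moebius_function_simple norm_divide norm_minus_commute mult.commute)
qed

text \<open>The different ways in which the Poincare distance controls Harnack's constant: exactly, for the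
  whole disc, and through a linear bound, for smaller discs.\<close>
lemma poincare_dist_properties:
  assumes "a \<in> ball 0 1" "b \<in> ball 0 1"
  defines "t \<equiv> norm (Moebius_function 0 b a)"
  shows "0 \<le> t" "t < 1" "t = tanh (poincare_dist a b)" "(1 + t) / (1 - t) = exp (2 * poincare_dist a b)"
    "t \<le> 2 * poincare_dist a b"
proof -
  show t: "0 \<le> t" "t < 1"
    using Moebius_function_norm_lt_1[of b a 0] assms by (auto simp: t_def)
  have d: "poincare_dist a b = ln ((1 + t) / (1 - t)) / 2"
    by (simp add: poincare_dist_def t_def artanh_def norm_Moebius_commute[of a b])
  show e: "(1 + t) / (1 - t) = exp (2 * poincare_dist a b)"
    using t by (simp add: d)
  define E where "E = exp (2 * poincare_dist a b)"
  have E: "E > 0" "(1 + t) / (1 - t) = E" using e by (auto simp: E_def)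
  have "tanh (poincare_dist a b) = (1 - 1 / E) / (1 + 1 / E)"
    by (simp add: tanh_real_altdef E_def exp_minus inverse_eq_divide)
  also have "\<dots> = ((E - 1) / E) / ((E + 1) / E)"
    using E(1) by (simp add: diff_divide_distrib add_divide_distrib)
  also have "\<dots> = (E - 1) / (E + 1)" using E(1) by simp
  also have "\<dots> = t" unfolding E(2)[symmetric] using t by (simp add: field_simps)
  finally show "t = tanh (poincare_dist a b)" ..
  have "exp t * (1 - t) \<le> exp t * exp (- t)"
    using exp_ge_add_one_self[of "- t"] by (intro mult_left_mono) auto
  then have "exp t \<le> 1 / (1 - t)"
    using t by (simp add: pos_le_divide_eq flip: exp_add)
  also have "\<dots> \<le> (1 + t) / (1 - t)"
    using t by (intro divide_right_mono) auto
  also note e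
  finally show "t \<le> 2 * poincare_dist a b" by simp
qed

lemma poincare_dist_nonneg:
  assumes "a \<in> ball 0 1" "b \<in> ball 0 1"
  shows "0 \<le> poincare_dist a b"
  using poincare_dist_properties(1,5)[OF assms] by linarith

section \<open>Chains of holomorphic discs\<close>

lemma kobayashi_dist_decreasing:
  assumes "\<And>f. f \<in> holomorphic_discs X \<Longrightarrow> G \<circ> f \<in> holomorphic_discs Y"
  shows "kobayashi_dist Y (G x) (G y) \<le> kobayashi_dist X x y"
  unfolding kobayashi_dist_def
proof (rule Inf_superset_mono, clarify)
  fix n :: nat and f a b p
  assume n: "0 < n"
    and chain: "\<forall>i<n. f i \<in> holomorphic_discs X \<and> a i \<in> ball 0 1 \<and> b i \<in> ball 0 1 \<and>
      f i (a i) = p i \<and> f i (b i) = p (Suc i)"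
  show "\<exists>n' f' a' b' p'. ereal (\<Sum>i<n. poincare_dist (a i) (b i)) =
      ereal (\<Sum>i<n'. poincare_dist (a' i) (b' i)) \<and>
      0 < n' \<and> p' 0 = G (p 0) \<and> p' n' = G (p n) \<and>
      (\<forall>i<n'. f' i \<in> holomorphic_discs Y \<and> a' i \<in> ball 0 1 \<and> b' i \<in> ball 0 1 \<and>
        f' i (a' i) = p' i \<and> f' i (b' i) = p' (Suc i))"
    using n chain assms
    by (intro exI[of _ n] exI[of _ "\<lambda>i. G \<circ> f i"] exI[of _ a] exI[of _ b] exI[of _ "G \<circ> p"]) auto
qed

text \<open>Chains are run through backwards: the end point is the fixed one in the applications, and the
  starting point varies.\<close>
lemma chain_growth:
  fixes v d :: "nat \<Rightarrow> real"
  assumes "\<And>i. i < n \<Longrightarrow> v i \<le> exp (K * d i) * v (Suc i)" and i: "i \<le> n"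
  shows "v i \<le> exp (K * (\<Sum>k=i..<n. d k)) * v n"
  using i
proof (induction rule: inc_induct)
  case (step i)
  have "v i \<le> exp (K * d i) * v (Suc i)" using assms(1) step by simp
  also have "\<dots> \<le> exp (K * d i) * (exp (K * (\<Sum>k=Suc i..<n. d k)) * v n)"
    using step by (intro mult_left_mono) auto
  also have "\<dots> = exp (K * (\<Sum>k=i..<n. d k)) * v n"
    using step by (simp add: sum.atLeast_Suc_lessThan[of i n] exp_add algebra_simps)
  finally show ?case .
qed simp

lemma chain_growth_total:
  fixes v d :: "nat \<Rightarrow> real"
  assumes "\<And>i. i < n \<Longrightarrow> v i \<le> exp (K * d i) * v (Suc i)"
    and "\<And>i. i < n \<Longrightarrow> 0 \<le> d i" "(\<Sum>k<n. d k) \<le> C" "0 \<le> K" "0 \<le> v n" "i \<le> n"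
  shows "v i \<le> exp (K * C) * v n"
proof -
  have "(\<Sum>k=i..<n. d k) \<le> (\<Sum>k<n. d k)"
    using assms(2) by (intro sum_mono2) auto
  then have "K * (\<Sum>k=i..<n. d k) \<le> K * C" using assms by (intro mult_left_mono) auto
  then have "exp (K * (\<Sum>k=i..<n. d k)) * v n \<le> exp (K * C) * v n"
    using assms by (intro mult_right_mono) auto
  moreover have "v i \<le> exp (K * (\<Sum>k=i..<n. d k)) * v n"
    by (rule chain_growth) (use assms in auto)
  ultimately show ?thesis by (rule order_trans[rotated])
qed

text \<open>A bounded plane domain is complete for chains: they cannot come close to the boundary within a
  bounded length.  For \<open>\<xi>\<close> outside \<open>V\<close> the function \<open>z - \<xi>\<close> has no zeros on \<open>V\<close>, so Harnack's
  inequality bounds \<open>- ln |z - \<xi>|\<close> along the chain by its value at the end point \<open>c0\<close>, that is, in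
  terms of the distance of \<open>c0\<close> to the boundary and of \<open>C\<close>; the bound is uniform in \<open>\<xi>\<close>.\<close>
lemma short_chain_stays_in_compact:
  fixes V :: "complex set"
  assumes V: "open V" "V \<subseteq> cball 0 2" "c0 \<in> V" and r: "0 < r" "r < 1"
  obtains K where "compact K" "K \<subseteq> V"
    "\<forall>n \<phi> a b c. c n = c0 \<and> (\<forall>i<n. \<phi> i holomorphic_on ball 0 1 \<and> \<phi> i ` ball 0 1 \<subseteq> V \<and>
        a i \<in> ball 0 1 \<and> b i \<in> ball 0 1 \<and> \<phi> i (a i) = c i \<and> \<phi> i (b i) = c (Suc i)) \<and>
        (\<Sum>i<n. poincare_dist (a i) (b i)) \<le> C \<longrightarrow>
      (\<forall>i<n. \<phi> i ` pseudohyperbolic_disc (b i) r \<subseteq> K)"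
proof -
  obtain \<eta>0 where \<eta>0: "\<eta>0 > 0" "ball c0 \<eta>0 \<subseteq> V" using V openE by blast
  \<comment> \<open>\<open>D\<close> bounds \<open>- ln |(z - \<xi>) / 6|\<close>: it is a bound for the value at \<open>c0\<close>, multiplied by
    Harnack's constants for the chain and for the disc that contains \<open>z\<close>.  The \<open>6\<close> makes the function smaller than \<open>1\<close> when
    \<open>|z| \<le> 2\<close> and \<open>|\<xi>| \<le> 3\<close>; points \<open>\<xi>\<close> farther out have distance at least \<open>1\<close> from \<open>V\<close>.\<close>
  define D where "D = (1 + r) / (1 - r) * (exp (2 * C) * - ln (min 1 \<eta>0 / 6))"
  define \<eta> where "\<eta> = min 1 (6 * exp (- D))"
  have \<eta>: "\<eta> > 0" by (simp add: \<eta>_def)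
  define K where "K = cball 0 2 \<inter> (\<Inter>\<xi>\<in>- V. {z. \<eta> \<le> dist z \<xi>})"
  show thesis
  proof (rule that[of K])
    have "closed {z. \<eta> \<le> dist z \<xi>}" for \<xi> :: complex
      by (intro closed_Collect_le continuous_intros)
    then show "compact K" unfolding K_def
      by (intro compact_Int_closed compact_cball closed_INT ballI)
    show "K \<subseteq> V"
    proof
      fix z assume z: "z \<in> K"
      show "z \<in> V"
      proof (rule ccontr)
        assume "z \<notin> V"
        then have "\<eta> \<le> dist z z" using z unfolding K_def by blast
        then show False using \<eta> by simp
      qed
    qed
    show "\<forall>n \<phi> a b c. c n = c0 \<and> (\<forall>i<n. \<phi> i holomorphic_on ball 0 1 \<and> \<phi> i ` ball 0 1 \<subseteq> V \<and>
        a i \<in> ball 0 1 \<and> b i \<in> ball 0 1 \<and> \<phi> i (a i) = c i \<and> \<phi> i (b i) = c (Suc i)) \<and>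
        (\<Sum>i<n. poincare_dist (a i) (b i)) \<le> C \<longrightarrow>
      (\<forall>i<n. \<phi> i ` pseudohyperbolic_disc (b i) r \<subseteq> K)"
    proof (intro allI impI subsetI, elim conjE imageE)
      fix n :: nat and \<phi> :: "nat \<Rightarrow> complex \<Rightarrow> complex" and a b c :: "nat \<Rightarrow> complex" and j z \<zeta>
      assume cn: "c n = c0"
        and chain: "\<forall>i<n. \<phi> i holomorphic_on ball 0 1 \<and> \<phi> i ` ball 0 1 \<subseteq> V \<and>
          a i \<in> ball 0 1 \<and> b i \<in> ball 0 1 \<and> \<phi> i (a i) = c i \<and> \<phi> i (b i) = c (Suc i)"
        and short: "(\<Sum>i<n. poincare_dist (a i) (b i)) \<le> C"
        and j: "j < n" and \<zeta>: "z = \<phi> j \<zeta>" "\<zeta> \<in> pseudohyperbolic_disc (b j) r"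
      have \<zeta>1: "\<zeta> \<in> ball 0 1" and \<zeta>r: "norm (Moebius_function 0 (b j) \<zeta>) < r"
        using \<zeta>(2) by (auto simp: pseudohyperbolic_disc_def)
      have zV: "z \<in> V" using chain j \<zeta>1 \<zeta>(1) by blast
      then have z2: "norm z \<le> 2" using V(2) by auto
      have "\<eta> \<le> dist z \<xi>" if \<xi>: "\<xi> \<notin> V" for \<xi>
      proof (cases "norm \<xi> \<le> 3")
        case False
        then have "1 \<le> dist z \<xi>" using z2 norm_triangle_ineq2[of \<xi> z] by (simp add: dist_norm norm_minus_commute)
        then show ?thesis by (simp add: \<eta>_def)
      next
        case True
        define g where "g = (\<lambda>i x. (\<phi> i x - \<xi>) / 6)"
        define v where "v = (\<lambda>i. - ln (norm ((c i - \<xi>) / 6)))"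
        have g_bd: "g i x \<noteq> 0 \<and> norm (g i x) < 1" if "i < n" "x \<in> ball 0 1" for i x
        proof -
          have "\<phi> i x \<in> V" using chain that by blast
          then have "\<phi> i x \<noteq> \<xi>" "norm (\<phi> i x) \<le> 2" using \<xi> V(2) by auto
          moreover have "norm (\<phi> i x - \<xi>) \<le> norm (\<phi> i x) + norm \<xi>" by (rule norm_triangle_ineq4)
          ultimately show ?thesis using True by (simp add: g_def norm_divide)
        qed
        have g_hol: "g i holomorphic_on pseudohyperbolic_disc (b i) 1" if "i < n" for i
        proof -
          have "\<phi> i holomorphic_on pseudohyperbolic_disc (b i) 1"
            by (rule holomorphic_on_subset[of _ "ball 0 1"])
               (use chain that in \<open>auto simp: pseudohyperbolic_disc_def\<close>)
          then show ?thesis unfolding g_def by (intro holomorphic_intros) auto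
        qed
        have harnack: "- ln (norm (g i x)) \<le> (1 + norm (Moebius_function 0 (b i) x)) /
            (1 - norm (Moebius_function 0 (b i) x)) * v (Suc i)"
          if "i < n" "x \<in> pseudohyperbolic_disc (b i) 1" for i x
        proof -
          have "- ln (norm (g i x)) \<le> (1 + norm (Moebius_function 0 (b i) x)) /
            (1 - norm (Moebius_function 0 (b i) x)) * - ln (norm (g i (b i)))"
            by (rule harnack_pseudohyperbolic_disc[OF _ _ _ g_hol[OF that(1)] _ that(2)])
               (use chain that g_bd in \<open>auto simp: pseudohyperbolic_disc_def\<close>)
          then show ?thesis using chain that by (simp add: v_def g_def)
        qed
        have v_step: "v i \<le> exp (2 * poincare_dist (a i) (b i)) * v (Suc i)" if i: "i < n" for i
        proof -
          have ab: "a i \<in> ball 0 1" "b i \<in> ball 0 1" and fa: "\<phi> i (a i) = c i" using chain i by auto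
          note pd = poincare_dist_properties[OF ab]
          have "a i \<in> pseudohyperbolic_disc (b i) 1"
            using ab pd(2) by (simp add: pseudohyperbolic_disc_def)
          from harnack[OF i this] show ?thesis
            unfolding pd(4) by (simp add: g_def v_def fa)
        qed
        have d_nonneg: "0 \<le> poincare_dist (a i) (b i)" if "i < n" for i
          by (rule poincare_dist_nonneg) (use chain that in auto)
        have far: "min 1 \<eta>0 \<le> norm (c0 - \<xi>)"
        proof -
          have "\<xi> \<notin> ball c0 \<eta>0" using \<xi> \<eta>0 by blast
          then show ?thesis by (simp add: dist_norm)
        qed
        have c0\<xi>: "norm ((c0 - \<xi>) / 6) < 1"
        proof -
          have "norm c0 \<le> 2" using V by auto
          then show ?thesis using True norm_triangle_ineq4[of c0 \<xi>] by (simp add: norm_divide)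
        qed
        have vn: "0 \<le> v n" "v n \<le> - ln (min 1 \<eta>0 / 6)"
        proof -
          have pos: "0 < min 1 \<eta>0 / 6" using \<eta>0 by simp
          moreover have le: "min 1 \<eta>0 / 6 \<le> norm ((c0 - \<xi>) / 6)" using far by (simp add: norm_divide)
          ultimately show "v n \<le> - ln (min 1 \<eta>0 / 6)" unfolding v_def cn by (simp add: ln_mono)
          have "0 < norm ((c0 - \<xi>) / 6)" using pos le by linarith
          then show "0 \<le> v n" unfolding v_def cn using c0\<xi> by (simp only: neg_0_le_iff_le) simp
        qed
        have v_le: "v (Suc j) \<le> exp (2 * C) * v n"
          by (rule chain_growth_total[of n v 2 "\<lambda>i. poincare_dist (a i) (b i)"])
             (use v_step d_nonneg short vn j in auto)
        define t where "t = norm (Moebius_function 0 (b j) \<zeta>)"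
        have t: "0 \<le> t" "t < r" using \<zeta>r by (auto simp: t_def)
        have \<zeta>p: "\<zeta> \<in> pseudohyperbolic_disc (b j) 1"
          using \<zeta>1 \<zeta>r r by (simp add: pseudohyperbolic_disc_def)
        have "- ln (norm (g j \<zeta>)) \<le> (1 + t) / (1 - t) * v (Suc j)"
          using harnack[OF j \<zeta>p] by (simp add: t_def)
        also have "\<dots> \<le> (1 + t) / (1 - t) * (exp (2 * C) * - ln (min 1 \<eta>0 / 6))"
        proof (rule mult_left_mono)
          have "exp (2 * C) * v n \<le> exp (2 * C) * - ln (min 1 \<eta>0 / 6)"
            using vn by (intro mult_left_mono) auto
          then show "v (Suc j) \<le> exp (2 * C) * - ln (min 1 \<eta>0 / 6)" using v_le by linarith
        qed (use t r in auto)
        also have "\<dots> \<le> (1 + r) / (1 - r) * (exp (2 * C) * - ln (min 1 \<eta>0 / 6))"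
          using t r vn by (intro mult_right_mono frac_le mult_nonneg_nonneg) auto
        finally have "- D \<le> ln (norm (g j \<zeta>))" unfolding D_def by linarith
        moreover have "g j \<zeta> \<noteq> 0" using g_bd[OF j \<zeta>1] by blast
        ultimately have "exp (- D) \<le> norm (g j \<zeta>)" by (simp add: ln_ge_iff)
        then have "6 * exp (- D) \<le> dist z \<xi>" by (simp add: g_def \<zeta>(1) norm_divide dist_norm)
        then show ?thesis by (simp add: \<eta>_def)
      qed
      then show "z \<in> K" using z2 by (simp add: K_def)
    qed
  qed
qed

section \<open>Attracting basins and images of their components\<close>

lemma attracting_basin_tendsto:
  assumes "x \<in> attracting_basin F c"
  shows "(\<lambda>n. (F ^^ n) x) \<longlonglongrightarrow> c"
proof -
  obtain U where U: "x \<in> U" "uniform_limit U (\<lambda>n. F ^^ n) (\<lambda>_. c) sequentially"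
    using assms by (auto simp: attracting_basin_def)
  show ?thesis using tendsto_uniform_limitI[OF U(2) U(1)] .
qed

lemma open_attracting_basin: "open (attracting_basin F c)"
proof (subst open_subopen, intro ballI)
  fix x assume "x \<in> attracting_basin F c"
  then obtain U where "open U" "x \<in> U" "uniform_limit U (\<lambda>n. F ^^ n) (\<lambda>_. c) sequentially"
    by (auto simp: attracting_basin_def)
  then show "\<exists>T. open T \<and> x \<in> T \<and> T \<subseteq> attracting_basin F c"
    by (intro exI[of _ U]) (auto simp: attracting_basin_def)
qed

lemma attracting_basin_vimage:
  assumes cont: "continuous_on UNIV F" and x: "F x \<in> attracting_basin F c"
  shows "x \<in> attracting_basin F c"
proof -
  obtain U where U: "open U" "F x \<in> U" "uniform_limit U (\<lambda>n. F ^^ n) (\<lambda>_. c) sequentially"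
    using x by (auto simp: attracting_basin_def)
  have "uniform_limit (F -` U) (\<lambda>n. F ^^ n) (\<lambda>_. c) sequentially"
    unfolding uniform_limit_iff
  proof (intro allI impI)
    fix e :: real assume "e > 0"
    then have "\<forall>\<^sub>F n in sequentially. \<forall>y\<in>U. dist ((F ^^ n) y) c < e"
      using U(3) by (simp add: uniform_limit_iff)
    then have "\<forall>\<^sub>F n in sequentially. \<forall>y\<in>F -` U. dist ((F ^^ Suc n) y) c < e"
      by eventually_elim (simp add: funpow_swap1)
    then show "\<forall>\<^sub>F n in sequentially. \<forall>y\<in>F -` U. dist ((F ^^ n) y) c < e"
      by (rule eventually_sequentially_Suc[THEN iffD1])
  qed
  moreover have "open (F -` U)" using cont U(1) by (simp add: continuous_on_open_vimage)
  ultimately show ?thesis using U(2) by (auto simp: attracting_basin_def)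
qed

lemma attracting_basin_image:
  assumes open_map: "\<And>U. open U \<Longrightarrow> open (F ` U)" and x: "x \<in> attracting_basin F c"
  shows "F x \<in> attracting_basin F c"
proof -
  obtain U where U: "open U" "x \<in> U" "uniform_limit U (\<lambda>n. F ^^ n) (\<lambda>_. c) sequentially"
    using x by (auto simp: attracting_basin_def)
  have "uniform_limit (F ` U) (\<lambda>n. F ^^ n) (\<lambda>_. c) sequentially"
    unfolding uniform_limit_iff
  proof (intro allI impI)
    fix e :: real assume "e > 0"
    then have "\<forall>\<^sub>F n in sequentially. \<forall>y\<in>U. dist ((F ^^ n) y) c < e"
      using U(3) by (simp add: uniform_limit_iff)
    then have "\<forall>\<^sub>F n in sequentially. \<forall>y\<in>U. dist ((F ^^ Suc n) y) c < e"
      by (rule eventually_sequentially_Suc[THEN iffD2])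
    then show "\<forall>\<^sub>F n in sequentially. \<forall>y\<in>F ` U. dist ((F ^^ n) y) c < e"
      by eventually_elim (simp add: funpow_swap1)
  qed
  then show ?thesis using U open_map[OF U(1)] by (auto simp: attracting_basin_def)
qed

text \<open>The image of a component is connected and open.  It is also closed in \<open>S\<close>: as \<open>S\<close> is bounded and
  completely invariant, it equals \<open>S \<inter> F ` closure A\<close>, and \<open>closure A\<close> is compact.  So the image
  fills the component that contains it.\<close>
lemma component_image_eq_component:
  fixes F :: "'a::euclidean_space \<Rightarrow> 'a"
  assumes S: "open S" "bounded S" and cont: "continuous_on UNIV F"
    and open_map: "\<And>U. open U \<Longrightarrow> open (F ` U)"
    and inv: "\<And>x. F x \<in> S \<longleftrightarrow> x \<in> S"
    and A: "A \<in> components S"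
  shows "F ` A \<in> components S"
proof -
  have AS: "A \<subseteq> S" by (rule in_components_subset[OF A])
  have FAS: "F ` A \<subseteq> S" using AS inv by auto
  have conn: "connected (F ` A)"
    by (intro connected_continuous_image continuous_on_subset[OF cont] in_components_connected[OF A]) auto
  have ne: "F ` A \<noteq> {}" using in_components_nonempty[OF A] by simp
  obtain D where D: "D \<in> components S" "F ` A \<subseteq> D"
    using exists_component_superset[OF FAS _ conn] ne FAS by blast
  have A_eq: "A = S \<inter> closure A"
  proof -
    obtain T where "closed T" "A = S \<inter> T"
      using closedin_component[OF A] by (auto simp: closedin_closed)
    moreover then have "closure A \<subseteq> T" by (intro closure_minimal) auto
    ultimately show ?thesis using closure_subset[of A] by blast
  qed
  have "F ` A = S \<inter> F ` closure A" using A_eq inv AS by blast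
  then have "F ` A = D \<inter> F ` closure A"
    using D in_components_subset[OF D(1)] by blast
  moreover have "compact (F ` closure A)"
    by (intro compact_continuous_image continuous_on_subset[OF cont])
       (use bounded_subset[OF S(2) AS] in auto)
  ultimately have "closedin (top_of_set D) (F ` A)"
    by (simp add: compact_imp_closed closedin_closed_Int)
  moreover have "openin (top_of_set D) (F ` A)"
    using open_map[OF open_components[OF S(1) A]] D(2) by (simp add: open_subset)
  ultimately have "F ` A = D"
    using in_components_connected[OF D(1)] ne unfolding connected_clopen by blast
  then show ?thesis using D(1) by simp
qed

section \<open>The basin of the map\<close>

definition P_map :: "real \<Rightarrow> complex \<Rightarrow> complex" where
  "P_map l z = complex_of_real l * z - z\<^sup>2"

lemma F_map_eq: "F_map l x = (P_map l (fst x), snd x - (snd x)\<^sup>2 - (fst x)\<^sup>2)"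
  by (cases x) (simp add: F_map_def P_map_def)

lemma fst_F_map_iterate: "fst ((F_map l ^^ n) x) = (P_map l ^^ n) (fst x)"
  by (induction n) (auto simp: F_map_eq)

lemma snd_F_map_Suc:
  "snd ((F_map l ^^ Suc n) x) =
     snd ((F_map l ^^ n) x) - (snd ((F_map l ^^ n) x))\<^sup>2 - ((P_map l ^^ n) (fst x))\<^sup>2"
  by (simp add: F_map_eq fst_F_map_iterate)

lemma continuous_on_F_map: "continuous_on S (F_map l)"
  unfolding F_map_eq[abs_def] P_map_def by (intro continuous_intros)

lemma F_map_iterate_holomorphic:
  assumes "(\<lambda>t. fst (f t)) holomorphic_on S" "(\<lambda>t. snd (f t)) holomorphic_on S"
  shows "(\<lambda>t. fst ((F_map l ^^ n) (f t))) holomorphic_on S \<and>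
         (\<lambda>t. snd ((F_map l ^^ n) (f t))) holomorphic_on S"
proof (induction n)
  case (Suc n)
  then show ?case unfolding funpow.simps o_def F_map_eq P_map_def fst_conv snd_conv
    by (intro conjI holomorphic_intros) auto
qed (use assms in simp)

lemma F_map_iterate_holomorphic_discs:
  assumes "f \<in> holomorphic_discs X" "(F_map l ^^ n) ` X \<subseteq> Y"
  shows "(F_map l ^^ n) \<circ> f \<in> holomorphic_discs Y"
  using assms F_map_iterate_holomorphic[where f = f and S = "ball 0 1" and l = l and n = n]
  unfolding holomorphic_discs_def by auto

lemma quadratic_open_map:
  assumes "open U"
  shows "open ((\<lambda>w::complex. a * w - w\<^sup>2) ` U)"
proof (rule open_mapping_thm[of _ UNIV])
  show "\<not> (\<lambda>w. a * w - w\<^sup>2) constant_on UNIV"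
  proof
    assume "(\<lambda>w. a * w - w\<^sup>2) constant_on UNIV"
    then obtain c where c: "\<And>w. a * w - w\<^sup>2 = c" by (auto simp: constant_on_def)
    show False using c[of 0] c[of 1] c[of 2] by simp
  qed
qed (use assms in \<open>auto intro!: holomorphic_intros\<close>)

text \<open>The map is triangular, so openness reduces to that of two quadratic polynomials: one solves for
  \<open>z\<close> near \<open>z0\<close> and then, with \<open>z\<close> known, for \<open>w\<close>.\<close>
lemma F_map_open_map:
  assumes U: "open U"
  shows "open (F_map l ` U)"
  unfolding open_subopen[of "F_map l ` U"]
proof
  fix y assume "y \<in> F_map l ` U"
  then obtain z0 w0 where x0: "(z0, w0) \<in> U" "y = F_map l (z0, w0)" by auto
  obtain A B where AB: "open A" "open B" "(z0, w0) \<in> A \<times> B" "A \<times> B \<subseteq> U"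
    using open_prod_elim[OF U x0(1)] by metis
  have "open ((\<lambda>w. w - w\<^sup>2) ` B)" using quadratic_open_map[OF AB(2), of 1] by simp
  moreover have "w0 - w0\<^sup>2 \<in> (\<lambda>w. w - w\<^sup>2) ` B" using AB(3) by blast
  ultimately obtain r where r: "r > 0" "ball (w0 - w0\<^sup>2) r \<subseteq> (\<lambda>w. w - w\<^sup>2) ` B"
    by (rule openE)
  define A' where "A' = A \<inter> (\<lambda>z. z\<^sup>2) -` ball (z0\<^sup>2) (r / 2)"
  have "open A'" unfolding A'_def
    by (intro open_Int AB open_vimage continuous_intros) auto
  then have "open (P_map l ` A')"
    using quadratic_open_map[of A' "complex_of_real l"] by (simp add: P_map_def[abs_def])
  moreover have "y \<in> P_map l ` A' \<times> ball (w0 - w0\<^sup>2 - z0\<^sup>2) (r / 2)"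
    using AB(3) r(1) by (auto simp: x0 F_map_eq A'_def)
  moreover have "P_map l ` A' \<times> ball (w0 - w0\<^sup>2 - z0\<^sup>2) (r / 2) \<subseteq> F_map l ` U"
  proof clarify
    fix z w' assume z: "z \<in> A'" and w': "w' \<in> ball (w0 - w0\<^sup>2 - z0\<^sup>2) (r / 2)"
    have "dist (w0 - w0\<^sup>2) (w' + z\<^sup>2) < r"
    proof -
      have "norm ((w0 - w0\<^sup>2 - z0\<^sup>2 - w') + (z0\<^sup>2 - z\<^sup>2)) < r / 2 + r / 2"
        using z w' by (intro norm_add_less) (auto simp: A'_def dist_norm)
      then show ?thesis by (simp add: dist_norm algebra_simps)
    qed
    then obtain w where w: "w \<in> B" "w' + z\<^sup>2 = w - w\<^sup>2" using r(2) by auto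
    have "F_map l (z, w) = (P_map l z, w')" using w(2) by (simp add: F_map_eq algebra_simps)
    moreover have "(z, w) \<in> U" using AB(4) z w by (auto simp: A'_def)
    ultimately show "(P_map l z, w') \<in> F_map l ` U" by force
  qed
  ultimately show "\<exists>T. open T \<and> y \<in> T \<and> T \<subseteq> F_map l ` U"
    by (intro exI[of _ "P_map l ` A' \<times> ball (w0 - w0\<^sup>2 - z0\<^sup>2) (r / 2)"] conjI open_Times open_ball)
qed

lemma F_map_mem_basin_iff:
  "F_map l x \<in> attracting_basin (F_map l) c \<longleftrightarrow> x \<in> attracting_basin (F_map l) c"
  using attracting_basin_vimage[OF continuous_on_F_map] attracting_basin_image[OF F_map_open_map]
  by blast

lemma F_map_iterate_mem_basin_iff:
  "(F_map l ^^ n) x \<in> attracting_basin (F_map l) c \<longleftrightarrow> x \<in> attracting_basin (F_map l) c"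
  by (induction n) (auto simp: F_map_mem_basin_iff)

text \<open>Used with \<open>X\<close> the modulus of a coordinate along an orbit: beyond a certain size the quadratic terms
  keep it from decreasing.\<close>
lemma tendsto_zero_imp_no_escape:
  fixes X :: "nat \<Rightarrow> real"
  assumes lim: "X \<longlonglongrightarrow> 0" and c: "0 \<le> c" and step: "\<And>n. c < X n \<Longrightarrow> X n \<le> X (Suc n)"
  shows "X 0 \<le> c"
proof (rule ccontr)
  assume "\<not> X 0 \<le> c"
  then have *: "X 0 \<le> X n" for n
  proof (induction n)
    case (Suc n)
    then show ?case using step[of n] by auto
  qed auto
  have "X 0 \<le> 0" by (rule LIMSEQ_le_const[OF lim]) (use * in auto)
  then show False using \<open>\<not> X 0 \<le> c\<close> c by simp
qed

lemma P_map_iterates_to_0_bound: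
  assumes l: "0 < l" "l < 1" and lim: "(\<lambda>n. (P_map l ^^ n) z) \<longlonglongrightarrow> 0"
  shows "norm z \<le> 2"
proof -
  have "norm ((P_map l ^^ 0) z) \<le> 2"
  proof (rule tendsto_zero_imp_no_escape[where X = "\<lambda>n. norm ((P_map l ^^ n) z)"])
    fix n assume *: "2 < norm ((P_map l ^^ n) z)"
    define y where "y = (P_map l ^^ n) z"
    have "norm (P_map l y) = norm y * norm (complex_of_real l - y)"
      by (simp add: P_map_def power2_eq_square flip: norm_mult) (simp add: algebra_simps)
    moreover have "norm (complex_of_real l - y) \<ge> 1"
      using norm_triangle_ineq2[of y "complex_of_real l"] * l
      by (simp add: y_def norm_minus_commute)
    ultimately have "norm y \<le> norm (P_map l y)" by (simp add: mult_le_cancel_left1)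
    then show "norm ((P_map l ^^ n) z) \<le> norm ((P_map l ^^ Suc n) z)" by (simp add: y_def)
  qed (use tendsto_norm_zero[OF lim] in auto)
  then show ?thesis by simp
qed

lemma basin_bounds:
  assumes l: "0 < l" "l < 1" and x: "x \<in> attracting_basin (F_map l) (0, 0)"
  shows "norm (fst x) \<le> 2" "norm (snd x) \<le> 4"
proof -
  have fst_le: "norm (fst y) \<le> 2" if "y \<in> attracting_basin (F_map l) (0, 0)" for y
    using P_map_iterates_to_0_bound[OF l] tendsto_fst[OF attracting_basin_tendsto[OF that]]
    by (simp add: fst_F_map_iterate)
  show "norm (fst x) \<le> 2" by (rule fst_le[OF x])
  have "norm (snd ((F_map l ^^ 0) x)) \<le> 4"
  proof (rule tendsto_zero_imp_no_escape[where X = "\<lambda>n. norm (snd ((F_map l ^^ n) x))"])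
    show "(\<lambda>n. norm (snd ((F_map l ^^ n) x))) \<longlonglongrightarrow> 0"
      using tendsto_norm_zero[OF tendsto_snd[OF attracting_basin_tendsto[OF x], simplified]] .
    fix n assume *: "4 < norm (snd ((F_map l ^^ n) x))"
    define z w where "z = fst ((F_map l ^^ n) x)" and "w = snd ((F_map l ^^ n) x)"
    have z2: "norm z \<le> 2" unfolding z_def
      by (rule fst_le) (simp add: F_map_iterate_mem_basin_iff x)
    have "norm (z\<^sup>2) \<le> 2\<^sup>2" unfolding norm_power by (intro power_mono z2) auto
    moreover have "norm (w\<^sup>2) = norm w * norm w" by (simp add: norm_power power2_eq_square[of "norm w"])
    moreover have "4 * norm w \<le> norm w * norm w"
      using * by (intro mult_right_mono) (auto simp: w_def)
    moreover have "norm (w\<^sup>2) - norm w - norm (z\<^sup>2) \<le> norm (w - w\<^sup>2 - z\<^sup>2)"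
    proof -
      have "norm (w - w\<^sup>2 - z\<^sup>2) = norm (w\<^sup>2 - (w - z\<^sup>2))"
        using norm_minus_commute[of "w - z\<^sup>2" "w\<^sup>2"] by (simp add: algebra_simps)
      then show ?thesis
        using norm_triangle_ineq2[of "w\<^sup>2" "w - z\<^sup>2"] norm_triangle_ineq4[of w "z\<^sup>2"]
        by linarith
    qed
    ultimately have "norm w \<le> norm (w - w\<^sup>2 - z\<^sup>2)" using * by (simp add: w_def)
    then show "norm (snd ((F_map l ^^ n) x)) \<le> norm (snd ((F_map l ^^ Suc n) x))"
      by (simp add: F_map_eq w_def z_def)
  qed simp
  then show "norm (snd x) \<le> 4" by simp
qed

lemma bounded_basin:
  assumes "0 < l" "l < 1"
  shows "bounded (attracting_basin (F_map l) (0, 0))"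
proof (rule bounded_subset)
  show "attracting_basin (F_map l) (0, 0) \<subseteq> cball 0 2 \<times> cball 0 4"
    using basin_bounds[OF assms] by force
qed (intro bounded_Times bounded_cball)

lemma F_map_iterate_component:
  assumes l: "0 < l" "l < 1" and A: "A \<in> components (attracting_basin (F_map l) (0, 0))"
  shows "(F_map l ^^ n) ` A \<in> components (attracting_basin (F_map l) (0, 0))"
proof (induction n)
  case (Suc n)
  have "F_map l ` ((F_map l ^^ n) ` A) \<in> components (attracting_basin (F_map l) (0, 0))"
    by (rule component_image_eq_component[OF open_attracting_basin bounded_basin[OF l]
          continuous_on_F_map F_map_open_map F_map_mem_basin_iff Suc])
  then show ?case by (simp add: image_comp)
qed (use A in simp)

section \<open>An attracting petal\<close>

text \<open>In the coordinate \<open>1 / w\<close> the map is close to the translation by \<open>1\<close>, up to the contribution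
  \<open>(z / w)\<^sup>2\<close>, which is large at first but decays geometrically.  The correction term with \<open>A\<close>
  compensates for it.  The condition \<open>petal_height A x > M\<close> is multiplied by \<open>|w|\<^sup>2\<close> here, so that the
  set is visibly open.\<close>
definition petal :: "real \<Rightarrow> real \<Rightarrow> (complex \<times> complex) set" where
  "petal A M = {x. norm (fst x) < 2 * norm (snd x) \<and>
     M * (norm (snd x))\<^sup>2 < Re (snd x) - A * (norm (fst x))\<^sup>2}"

definition petal_height :: "real \<Rightarrow> complex \<times> complex \<Rightarrow> real" where
  "petal_height A x = Re (1 / snd x) - A * (norm (fst x / snd x))\<^sup>2"

lemma petal_iff:
  "x \<in> petal A M \<longleftrightarrow> norm (fst x) < 2 * norm (snd x) \<and> M < petal_height A x"
proof (cases "snd x = 0")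
  case False
  have "petal_height A x = (Re (snd x) - A * (norm (fst x))\<^sup>2) / (norm (snd x))\<^sup>2"
    by (simp add: petal_height_def Re_divide cmod_power2 norm_divide power_divide diff_divide_distrib)
  then show ?thesis using False by (auto simp: petal_def pos_less_divide_eq)
qed (simp add: petal_def)

lemma open_petal: "open (petal A M)"
  unfolding petal_def by (intro open_Collect_conj open_Collect_less continuous_intros)

lemma norm_le_inverse_Re:
  fixes w :: complex
  assumes "0 < c" "c < Re (1 / w)"
  shows "norm w < 1 / c"
proof -
  have "c < norm (1 / w)" using assms complex_Re_le_cmod[of "1 / w"] by linarith
  moreover have "w \<noteq> 0" using assms by auto
  ultimately show ?thesis using assms(1) by (simp add: norm_divide field_simps)
qed

text \<open>With \<open>s = z / w\<close>, one step adds \<open>1 + s\<^sup>2\<close> to \<open>1 / w\<close>, up to an error of at most \<open>1 / 2\<close>, and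
  multiplies \<open>|s|\<close> by at most \<open>\<mu> < 1\<close>.  The constant \<open>A\<close> solves \<open>A = 1 + A \<mu>\<^sup>2\<close>, so the loss
  \<open>|s|\<^sup>2\<close> in \<open>Re (1 / w)\<close> is exactly paid for by the decrease of \<open>A |s|\<^sup>2\<close>.\<close>
lemma petal_step:
  fixes l :: real
  assumes l: "0 < l" "l < 1"
  defines "\<mu> \<equiv> (1 + l) / 2"
  defines "A \<equiv> 1 / (1 - \<mu>\<^sup>2)" and "M \<equiv> 100 / (1 - l)"
  assumes x: "x \<in> petal A M"
  shows "F_map l x \<in> petal A M" "petal_height A x + 1 / 2 \<le> petal_height A (F_map l x)"
proof -
  define z w where "z = fst x" and "w = snd x"
  define s where "s = z / w"
  \<comment> \<open>In these terms \<open>F (z, w) = (z (l - z), w (1 - y))\<close>.\<close>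
  define y where "y = w * (1 + s\<^sup>2)"
  define \<eta> where "\<eta> = (1 - l) / 100"
  have \<mu>: "0 < \<mu>" "\<mu> < 1" "l + 50 * \<eta> = \<mu>" using l by (auto simp: \<mu>_def \<eta>_def field_simps)
  have \<mu>2: "\<mu>\<^sup>2 < 1" using \<mu> by (simp add: power_less_one_iff abs_square_less_1)
  have A: "A > 0" "A * (1 - \<mu>\<^sup>2) = 1" using \<mu>2 by (auto simp: A_def)
  have \<eta>: "0 < \<eta>" "\<eta> < 1 / 100" "M = 1 / \<eta>" using l by (auto simp: \<eta>_def M_def)
  have zw: "norm z < 2 * norm w" and h: "M < petal_height A x"
    using x by (auto simp: petal_iff z_def w_def)
  have w0: "w \<noteq> 0" using zw by auto
  have zs: "z = s * w" using w0 by (simp add: s_def)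
  have s: "norm s < 2" using zw w0 by (simp add: s_def norm_divide divide_simps)
  have hx: "petal_height A x = Re (1 / w) - A * (norm s)\<^sup>2"
    by (simp add: petal_height_def z_def w_def s_def)
  have "0 \<le> A * (norm s)\<^sup>2" using A by simp
  then have "M < Re (1 / w)" using h hx by linarith
  then have w\<eta>: "norm w < \<eta>" using norm_le_inverse_Re[of M w] \<eta> by simp
  have s2: "norm (1 + s\<^sup>2) \<le> 5"
  proof -
    have "norm s * norm s \<le> 2 * 2" using s by (intro mult_mono) auto
    then show ?thesis using norm_triangle_ineq[of 1 "s\<^sup>2"] by (simp add: norm_mult power2_eq_square)
  qed
  have y: "norm y \<le> 5 * \<eta>"
  proof -
    have "norm w * norm (1 + s\<^sup>2) \<le> \<eta> * 5" using w\<eta> s2 \<eta> by (intro mult_mono) auto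
    then show ?thesis by (simp add: y_def norm_mult)
  qed
  have y1: "1 - 5 * \<eta> \<le> norm (1 - y)" using norm_triangle_ineq2[of 1 y] y by simp
  have pos: "0 < 1 - 5 * \<eta>" using \<eta> by simp
  have y0: "1 - y \<noteq> 0" using y1 pos by auto
  have w': "snd (F_map l x) = w * (1 - y)"
    by (simp add: F_map_eq y_def zs power2_eq_square algebra_simps flip: z_def w_def)
  have z': "fst (F_map l x) = z * (l - z)"
    by (simp add: F_map_eq P_map_def power2_eq_square algebra_simps flip: z_def)
  have inv_w': "1 / snd (F_map l x) = 1 / w + (1 + s\<^sup>2) + (1 + s\<^sup>2) * y / (1 - y)"
  proof -
    have "1 / (w * (1 - y)) = 1 / w + (y / w) / (1 - y)"
      using w0 y0 by (simp add: field_simps)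
    also have "y / w = 1 + s\<^sup>2" using w0 by (simp add: y_def)
    also have "(1 + s\<^sup>2) / (1 - y) = (1 + s\<^sup>2) + (1 + s\<^sup>2) * y / (1 - y)"
      using y0 by (simp add: field_simps)
    finally show ?thesis by (simp add: w')
  qed
  have err: "norm ((1 + s\<^sup>2) * y / (1 - y)) \<le> 1 / 2"
  proof -
    have "norm (1 + s\<^sup>2) * norm y \<le> 5 * (5 * \<eta>)" using s2 y by (intro mult_mono) auto
    also have "\<dots> \<le> 1 / 2 * (1 - 5 * \<eta>)" using \<eta> by simp
    also have "\<dots> \<le> 1 / 2 * norm (1 - y)" using y1 by simp
    finally show ?thesis using y0 by (simp add: norm_divide norm_mult divide_simps)
  qed
  have Re_ge: "Re (1 / w) + 1 / 2 - (norm s)\<^sup>2 \<le> Re (1 / snd (F_map l x))"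
  proof -
    have "- Re ((1 + s\<^sup>2) * y / (1 - y)) \<le> 1 / 2"
      using err abs_Re_le_cmod[of "(1 + s\<^sup>2) * y / (1 - y)"] by linarith
    moreover have "- Re (s\<^sup>2) \<le> (norm s)\<^sup>2"
      using abs_Re_le_cmod[of "s\<^sup>2"] by (simp add: norm_power)
    ultimately show ?thesis unfolding inv_w' by simp
  qed
  have s': "norm (fst (F_map l x) / snd (F_map l x)) \<le> \<mu> * norm s"
  proof -
    have "norm (complex_of_real l - z) \<le> l + norm z"
      using norm_triangle_ineq4[of "complex_of_real l" z] l by simp
    also have "\<dots> \<le> l + 2 * \<eta>" using zw w\<eta> by simp
    also have "\<dots> \<le> \<mu> * (1 - 5 * \<eta>)"
    proof -
      have "\<mu> * (5 * \<eta>) \<le> 1 * (5 * \<eta>)" using \<mu> \<eta> by (intro mult_right_mono) auto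
      then show ?thesis unfolding right_diff_distrib using \<mu>(3) \<eta>(1) by linarith
    qed
    also have "\<dots> \<le> \<mu> * norm (1 - y)" using y1 \<mu> by simp
    finally have "norm (complex_of_real l - z) / norm (1 - y) \<le> \<mu>"
      using y0 by (simp add: pos_divide_le_eq)
    then have "norm s * (norm (complex_of_real l - z) / norm (1 - y)) \<le> norm s * \<mu>"
      by (intro mult_left_mono) auto
    then show ?thesis by (simp add: w' z' s_def norm_divide norm_mult mult.commute)
  qed
  have "(norm (fst (F_map l x) / snd (F_map l x)))\<^sup>2 \<le> (\<mu> * norm s)\<^sup>2"
    using s' by (intro power_mono) auto
  then have "A * (norm (fst (F_map l x) / snd (F_map l x)))\<^sup>2 \<le> A * (\<mu>\<^sup>2 * (norm s)\<^sup>2)"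
    using A by (intro mult_left_mono) (auto simp: power_mult_distrib)
  also have "\<dots> = A * (norm s)\<^sup>2 - A * (1 - \<mu>\<^sup>2) * (norm s)\<^sup>2" by (simp add: algebra_simps)
  also have "\<dots> = A * (norm s)\<^sup>2 - (norm s)\<^sup>2" unfolding A(2) by simp
  finally show step: "petal_height A x + 1 / 2 \<le> petal_height A (F_map l x)"
    using Re_ge unfolding petal_height_def[of A "F_map l x"] hx by linarith
  have "\<mu> * norm s < 2"
    using mult_mono[of \<mu> 1 "norm s" "norm s"] \<mu> s by simp
  then have "norm (fst (F_map l x) / snd (F_map l x)) < 2" using s' by linarith
  moreover have "snd (F_map l x) \<noteq> 0" using w' w0 y0 by simp
  ultimately have "norm (fst (F_map l x)) < 2 * norm (snd (F_map l x))"
    by (simp add: norm_divide divide_simps)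
  then show "F_map l x \<in> petal A M" using step h by (simp add: petal_iff)
qed

lemma petal_subset_basin:
  fixes l :: real
  assumes l: "0 < l" "l < 1"
  defines "\<mu> \<equiv> (1 + l) / 2"
  defines "A \<equiv> 1 / (1 - \<mu>\<^sup>2)" and "M \<equiv> 100 / (1 - l)"
  shows "petal A M \<subseteq> attracting_basin (F_map l) (0, 0)"
proof -
  have "\<mu>\<^sup>2 < 1" using l by (simp add: \<mu>_def power_less_one_iff abs_square_less_1)
  then have A: "A \<ge> 0" by (simp add: A_def)
  have M: "M > 0" using l by (simp add: M_def)
  have iter: "(F_map l ^^ n) x \<in> petal A M \<and> M + n / 2 < petal_height A ((F_map l ^^ n) x)"
    if "x \<in> petal A M" for x n
  proof (induction n)
    case 0
    then show ?case using that by (simp add: petal_iff)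
  next
    case (Suc n)
    then show ?case
      using petal_step[OF l, of "(F_map l ^^ n) x", folded \<mu>_def, folded A_def M_def]
      by (auto simp: add_divide_distrib)
  qed
  have bound: "norm ((F_map l ^^ n) x) \<le> 3 / (M + n / 2)" if "x \<in> petal A M" for x n
  proof -
    define z w where "z = fst ((F_map l ^^ n) x)" and "w = snd ((F_map l ^^ n) x)"
    have "M + n / 2 < petal_height A ((F_map l ^^ n) x)" using iter[OF that] by blast
    also have "\<dots> \<le> Re (1 / w)" using A by (simp add: petal_height_def w_def)
    finally have "norm w < 1 / (M + n / 2)" using M by (intro norm_le_inverse_Re) auto
    moreover have "norm z < 2 * norm w"
      using iter[OF that, of n] by (simp add: petal_iff z_def w_def)
    moreover have "norm ((F_map l ^^ n) x) \<le> norm z + norm w"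
      using norm_Pair_le[of z w] by (simp add: z_def w_def)
    ultimately have "norm ((F_map l ^^ n) x) \<le> 3 * (1 / (M + n / 2))" by linarith
    then show ?thesis by simp
  qed
  have "uniform_limit (petal A M) (\<lambda>n. F_map l ^^ n) (\<lambda>_. (0, 0)) sequentially"
    unfolding uniform_limit_iff
  proof (intro allI impI)
    fix e :: real assume e: "e > 0"
    have "(\<lambda>n. 3 / (M + real n / 2)) \<longlonglongrightarrow> 0" by real_asymp
    then have "\<forall>\<^sub>F n in sequentially. 3 / (M + real n / 2) < e"
      using e by (auto simp: order_tendsto_iff)
    then show "\<forall>\<^sub>F n in sequentially. \<forall>x\<in>petal A M. dist ((F_map l ^^ n) x) (0, 0) < e"
    proof eventually_elim
      case (elim n)
      show ?case
      proof
        fix x assume "x \<in> petal A M"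
        from bound[OF this, of n] elim show "dist ((F_map l ^^ n) x) (0, 0) < e"
          by (simp flip: zero_prod_def)
      qed
    qed
  qed
  then show ?thesis unfolding attracting_basin_def using open_petal by blast
qed

text \<open>For small \<open>b > 0\<close> all real points \<open>(a, b)\<close> with \<open>|a| < 2 b\<close> lie in the petal.  The segment
  consists of such points.\<close>
lemma segment_in_basin:
  assumes l: "0 < l" "l < 1"
  obtains \<epsilon>0 where "\<epsilon>0 > 0" "\<And>\<epsilon>. 0 < \<epsilon> \<Longrightarrow> \<epsilon> < \<epsilon>0 \<Longrightarrow>
    closed_segment (complex_of_real \<epsilon>, complex_of_real \<epsilon>)
      (F_map l (complex_of_real \<epsilon>, complex_of_real \<epsilon>)) \<subseteq> attracting_basin (F_map l) (0, 0)"
proof -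
  define \<mu> where "\<mu> = (1 + l) / 2"
  define A where "A = 1 / (1 - \<mu>\<^sup>2)"
  define M where "M = 100 / (1 - l)"
  have "\<mu>\<^sup>2 < 1" using l by (simp add: \<mu>_def power_less_one_iff abs_square_less_1)
  then have A: "A \<ge> 0" by (simp add: A_def)
  have M: "M > 0" using l by (simp add: M_def)
  have sub: "petal A M \<subseteq> attracting_basin (F_map l) (0, 0)"
    unfolding A_def \<mu>_def M_def by (rule petal_subset_basin[OF l])
  have real_petal: "(complex_of_real a, complex_of_real b) \<in> petal A M"
    if "0 < b" "\<bar>a\<bar> < 2 * b" "b < 1 / (4 * A + M)" for a b :: real
  proof -
    have "a\<^sup>2 \<le> (2 * b)\<^sup>2" using that by (intro abs_le_square_iff[THEN iffD1]) auto
    then have "A * a\<^sup>2 \<le> A * (4 * b\<^sup>2)" using A by (intro mult_left_mono) (auto simp: power_mult_distrib)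
    then have "M * b\<^sup>2 + A * a\<^sup>2 \<le> b * ((4 * A + M) * b)"
      by (simp add: algebra_simps power2_eq_square)
    also have "\<dots> < b * 1"
      using that A M by (intro mult_strict_left_mono) (auto simp: field_simps)
    finally show ?thesis using that by (simp add: petal_def)
  qed
  show thesis
  proof (rule that[of "min (1 / 4) (1 / (4 * A + M))"])
    show "min (1 / 4) (1 / (4 * A + M)) > 0" using A M by simp
    fix \<epsilon> :: real assume \<epsilon>: "0 < \<epsilon>" "\<epsilon> < min (1 / 4) (1 / (4 * A + M))"
    show "closed_segment (complex_of_real \<epsilon>, complex_of_real \<epsilon>)
      (F_map l (complex_of_real \<epsilon>, complex_of_real \<epsilon>)) \<subseteq> attracting_basin (F_map l) (0, 0)"
    proof
      fix x assume "x \<in> closed_segment (complex_of_real \<epsilon>, complex_of_real \<epsilon>)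
        (F_map l (complex_of_real \<epsilon>, complex_of_real \<epsilon>))"
      then obtain t where t: "0 \<le> t" "t \<le> 1"
        "x = (1 - t) *\<^sub>R (complex_of_real \<epsilon>, complex_of_real \<epsilon>) +
             t *\<^sub>R F_map l (complex_of_real \<epsilon>, complex_of_real \<epsilon>)"
        by (auto simp: closed_segment_def)
      define a where "a = (1 - t) * \<epsilon> + t * (l * \<epsilon> - \<epsilon>\<^sup>2)"
      define b where "b = \<epsilon> - 2 * (t * \<epsilon>\<^sup>2)"
      have "x = (complex_of_real a, complex_of_real b)"
        by (simp add: t F_map_def a_def b_def scaleR_conv_of_real algebra_simps)
      moreover have "(complex_of_real a, complex_of_real b) \<in> petal A M"
      proof (rule real_petal)
        have e2: "\<epsilon>\<^sup>2 \<le> \<epsilon> * (1 / 4)" "0 \<le> \<epsilon>\<^sup>2" "\<epsilon>\<^sup>2 < \<epsilon> * (1/4)"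
          using \<epsilon> mult_strict_left_mono[of \<epsilon> "1 / 4" \<epsilon>] by (auto simp: power2_eq_square)
        have te2: "t * \<epsilon>\<^sup>2 \<le> 1 * \<epsilon>\<^sup>2" "0 \<le> t * \<epsilon>\<^sup>2"
          using t by (simp_all add: mult_left_le_one_le)
        have tle: "0 \<le> t * (l * \<epsilon>)" "t * (l * \<epsilon>) \<le> t * (1 * \<epsilon>)" "t * \<epsilon> \<le> 1 * \<epsilon>"
          using t l \<epsilon> by (auto intro!: mult_left_mono mult_right_mono)
        have a: "a = \<epsilon> - t * \<epsilon> + t * (l * \<epsilon>) - t * \<epsilon>\<^sup>2" by (simp add: a_def algebra_simps)
        show "0 < b" using te2 e2 unfolding b_def by linarith
        have "\<bar>e - s + v - u\<bar> < 2 * (e - 2 * u)"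
          if "u \<le> q" "0 \<le> u" "q < e / 4" "0 \<le> v" "v \<le> s" "s \<le> e" for e q s u v :: real
          unfolding abs_less_iff using that by argo
        from this[of "t * \<epsilon>\<^sup>2" "\<epsilon>\<^sup>2" \<epsilon> "t * (l * \<epsilon>)" "t * \<epsilon>"]
        show "\<bar>a\<bar> < 2 * b" unfolding a b_def using te2 e2 tle by simp
        show "b < 1 / (4 * A + M)" using te2 \<epsilon> by (simp add: b_def)
      qed
      ultimately show "x \<in> attracting_basin (F_map l) (0, 0)" using sub by auto
    qed
  qed
qed

section \<open>The basin of the first coordinate\<close>

lemma P_map_contraction:
  assumes l: "0 < l" "l < 1" and z: "norm z \<le> (1 - l) / 2"
  shows "norm (P_map l z) \<le> (1 + l) / 2 * norm z"
proof -
  have "norm (complex_of_real l - z) \<le> (1 + l) / 2"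
    using norm_triangle_ineq4[of "complex_of_real l" z] l z by simp
  then have "norm z * norm (complex_of_real l - z) \<le> norm z * ((1 + l) / 2)"
    by (intro mult_left_mono) auto
  moreover have "P_map l z = z * (complex_of_real l - z)"
    by (simp add: P_map_def power2_eq_square algebra_simps)
  ultimately show ?thesis by (simp add: norm_mult mult.commute)
qed

lemma P_map_iterate_bound:
  assumes l: "0 < l" "l < 1" and z: "norm z \<le> (1 - l) / 2"
  shows "norm ((P_map l ^^ n) z) \<le> ((1 + l) / 2) ^ n * norm z"
proof (induction n)
  case (Suc n)
  have "((1 + l) / 2) ^ n * norm z \<le> 1 * norm z"
    using l by (intro mult_right_mono power_le_one) auto
  then have "norm ((P_map l ^^ n) z) \<le> (1 - l) / 2" using Suc z by linarith
  then have "norm ((P_map l ^^ Suc n) z) \<le> (1 + l) / 2 * norm ((P_map l ^^ n) z)"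
    using P_map_contraction[OF l] by simp
  also have "\<dots> \<le> (1 + l) / 2 * (((1 + l) / 2) ^ n * norm z)"
    using Suc l by (intro mult_left_mono) auto
  finally show ?case by (simp add: mult.assoc)
qed simp

lemma continuous_on_P_map_iterate: "continuous_on S (P_map l ^^ n)"
proof (induction n)
  case (Suc n)
  have "continuous_on S (\<lambda>z. complex_of_real l * (P_map l ^^ n) z - ((P_map l ^^ n) z)\<^sup>2)"
    by (intro continuous_intros Suc)
  then show ?case by (simp add: P_map_def[abs_def] o_def)
qed (simp add: id_def)

definition P_basin :: "real \<Rightarrow> complex set" where
  "P_basin l = {z. (\<lambda>n. (P_map l ^^ n) z) \<longlonglongrightarrow> 0}"

lemma P_basin_eq_Union:
  assumes l: "0 < l" "l < 1" and d: "0 < d" "d \<le> (1 - l) / 2"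
  shows "P_basin l = (\<Union>n. (P_map l ^^ n) -` ball 0 d)"
proof (intro set_eqI iffI)
  fix z assume "z \<in> P_basin l"
  then have "(\<lambda>n. (P_map l ^^ n) z) \<longlonglongrightarrow> 0" by (simp add: P_basin_def)
  then have "\<forall>\<^sub>F n in sequentially. dist ((P_map l ^^ n) z) 0 < d" by (rule tendstoD) (rule d(1))
  then show "z \<in> (\<Union>n. (P_map l ^^ n) -` ball 0 d)"
    using eventually_happens'[OF sequentially_bot] by (auto simp: dist_commute)
next
  fix z assume "z \<in> (\<Union>n. (P_map l ^^ n) -` ball 0 d)"
  then obtain N where "norm ((P_map l ^^ N) z) < d" by auto
  then have N: "norm ((P_map l ^^ N) z) \<le> (1 - l) / 2" using d by linarith
  have "(\<lambda>n. (P_map l ^^ (n + N)) z) \<longlonglongrightarrow> 0"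
  proof (rule Lim_null_comparison)
    show "\<forall>\<^sub>F n in sequentially.
        norm ((P_map l ^^ (n + N)) z) \<le> ((1 + l) / 2) ^ n * norm ((P_map l ^^ N) z)"
      using P_map_iterate_bound[OF l N] by (simp add: funpow_add)
    show "(\<lambda>n. ((1 + l) / 2) ^ n * norm ((P_map l ^^ N) z)) \<longlonglongrightarrow> 0"
      using l by (intro tendsto_mult_left_zero LIMSEQ_realpow_zero) auto
  qed
  then show "z \<in> P_basin l" unfolding P_basin_def by (simp add: LIMSEQ_offset)
qed

lemma open_P_basin:
  assumes l: "0 < l" "l < 1"
  shows "open (P_basin l)"
proof -
  have "P_basin l = (\<Union>n. (P_map l ^^ n) -` ball 0 ((1 - l) / 2))"
    using l by (intro P_basin_eq_Union) auto
  then show ?thesis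
    by (auto intro: open_vimage[OF open_ball continuous_on_P_map_iterate])
qed

text \<open>The sets of points that need at most \<open>n\<close> steps to enter the disc of radius \<open>d\<close> are open, increase
  with \<open>n\<close> and exhaust the basin.\<close>
lemma P_map_iterate_uniformly_small_on_compact:
  assumes l: "0 < l" "l < 1" and d: "0 < d" "d \<le> (1 - l) / 2"
    and K: "compact K" "K \<subseteq> P_basin l"
  obtains m where "\<And>z. z \<in> K \<Longrightarrow> norm ((P_map l ^^ m) z) < d"
proof -
  let ?U = "\<lambda>n. (P_map l ^^ n) -` ball 0 d"
  have mono: "?U n \<subseteq> ?U m" if "n \<le> m" for n m
  proof
    fix z assume "z \<in> ?U n"
    then have z: "norm ((P_map l ^^ n) z) < d" by simp
    then have "norm ((P_map l ^^ (m - n)) ((P_map l ^^ n) z))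
        \<le> ((1 + l) / 2) ^ (m - n) * norm ((P_map l ^^ n) z)"
      using d by (intro P_map_iterate_bound[OF l]) auto
    also have "\<dots> \<le> 1 * norm ((P_map l ^^ n) z)"
      using l by (intro mult_right_mono power_le_one) auto
    also have "(P_map l ^^ (m - n)) ((P_map l ^^ n) z) = (P_map l ^^ m) z"
      using that by (simp flip: funpow_add comp_apply[of "P_map l ^^ (m - n)"])
    finally show "z \<in> ?U m" using z by simp
  qed
  have op: "open (?U n)" for n
    by (rule open_vimage[OF open_ball continuous_on_P_map_iterate])
  have "K \<subseteq> (\<Union>n. ?U n)" using K(2) P_basin_eq_Union[OF l d] by simp
  then obtain C where C: "finite C" "K \<subseteq> (\<Union>n\<in>C. ?U n)"
    by (rule compactE_image[OF K(1) op])
  define N where "N = Max (insert 0 C)"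
  have "z \<in> ?U N" if "z \<in> K" for z
  proof -
    obtain n where n: "n \<in> C" "z \<in> ?U n" using C(2) \<open>z \<in> K\<close> by blast
    then have "n \<le> N" using C(1) by (simp add: N_def)
    then show ?thesis using mono n(2) by blast
  qed
  then show thesis by (intro that[of N]) simp
qed

section \<open>The strong stable manifold\<close>

text \<open>The branch at \<open>0\<close> of the inverse of \<open>w - w\<^sup>2\<close>.  Its derivative at \<open>0\<close> is \<open>1\<close>, hence the Lipschitz
  constant \<open>1 / c\<close> is available for every \<open>c < 1\<close> on a sufficiently small disc.\<close>
lemma holomorphic_inverse_branch:
  assumes c: "0 < c" "c < (1::real)"
  obtains \<rho> g where "0 < \<rho>" "g holomorphic_on ball 0 \<rho>" "g 0 = 0"
    "\<forall>v \<in> ball 0 \<rho>. g v - (g v)\<^sup>2 = v"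
    "\<forall>v \<in> ball 0 \<rho>. \<forall>v' \<in> ball 0 \<rho>. c * norm (g v - g v') \<le> norm (v - v')"
proof -
  define g where "g = (\<lambda>v::complex. (1 - csqrt (1 - 4 * v)) / 2)"
  have g_eq: "g v - (g v)\<^sup>2 = v" for v
  proof -
    have "(csqrt (1 - 4 * v))\<^sup>2 = 1 - 4 * v" by (rule power2_csqrt)
    then show ?thesis by (simp add: g_def power2_eq_square field_simps)
  qed
  have notin: "1 - 4 * v \<notin> \<real>\<^sub>\<le>\<^sub>0" if "v \<in> ball 0 (1 / 4)" for v :: complex
  proof
    assume "1 - 4 * v \<in> \<real>\<^sub>\<le>\<^sub>0"
    then have "Re (1 - 4 * v) \<le> 0" by (simp add: complex_nonpos_Reals_iff)
    then have "1 / 4 \<le> norm v" using complex_Re_le_cmod[of v] by simp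
    then show False using that by simp
  qed
  have hol: "g holomorphic_on ball 0 (1 / 4)"
    unfolding g_def using notin by (intro holomorphic_intros) auto
  have "isCont g 0"
    using continuous_on_eq_continuous_at[OF open_ball, of 0 "1 / 4" g]
      holomorphic_on_imp_continuous_on[OF hol] by simp
  then have lim: "g \<midarrow>0\<rightarrow> g 0" by (rule isContD)
  have g0: "g 0 = 0" by (simp add: g_def)
  have "(1 - c) / 2 > 0" using c by simp
  from LIM_D[OF lim this] obtain d where
    d: "d > 0" "\<And>v. v \<noteq> 0 \<Longrightarrow> norm v < d \<Longrightarrow> norm (g v) < (1 - c) / 2"
    by (auto simp: g0)
  have d': "norm (g v) < (1 - c) / 2" if "norm v < d" for v
    using d(2)[OF _ that] g0 c by (cases "v = 0") auto
  show thesis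
  proof (rule that[of "min d (1 / 4)" g])
    show "g holomorphic_on ball 0 (min d (1 / 4))"
      by (rule holomorphic_on_subset[OF hol]) auto
    show "\<forall>v \<in> ball 0 (min d (1 / 4)). \<forall>v' \<in> ball 0 (min d (1 / 4)).
        c * norm (g v - g v') \<le> norm (v - v')"
    proof (intro ballI)
      fix v v' :: complex assume v: "v \<in> ball 0 (min d (1 / 4))" and v': "v' \<in> ball 0 (min d (1 / 4))"
      have "v - v' = (g v - g v') * (1 - g v - g v')"
        using g_eq[of v] g_eq[of v'] by (simp add: power2_eq_square algebra_simps)
      then have "norm (v - v') = norm (g v - g v') * norm (1 - g v - g v')" by (simp add: norm_mult)
      moreover have "c \<le> norm (1 - g v - g v')"
      proof -
        have "norm (g v) < (1 - c) / 2" "norm (g v') < (1 - c) / 2" using d' v v' by auto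
        moreover have "1 \<le> norm (1 - g v - g v') + norm (g v) + norm (g v')"
          using norm_triangle_ineq[of "1 - g v - g v'" "g v + g v'"] norm_triangle_ineq[of "g v" "g v'"]
          by simp
        ultimately show ?thesis by argo
      qed
      ultimately show "c * norm (g v - g v') \<le> norm (v - v')"
        using mult_right_mono[of c "norm (1 - g v - g v')" "norm (g v - g v')"] by (simp add: mult.commute)
    qed
  qed (use d g0 g_eq in auto)
qed


text \<open>The graph of \<open>h\<close> is invariant when \<open>h z = g (h (P z) + z\<^sup>2)\<close>, with \<open>g\<close> the inverse of
  \<open>w - w\<^sup>2\<close>.  The operator on the right is not a contraction for the uniform norm, since \<open>g\<close> has
  derivative \<open>1\<close> at \<open>0\<close>.  But on functions that are \<open>O(z\<^sup>2)\<close>, with the norm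
  \<open>sup |h z| / |z|\<^sup>2\<close>, composition with \<open>P\<close> gains the factor \<open>\<mu>\<^sup>2\<close>, which outweighs
  the Lipschitz constant \<open>1 / \<mu>\<close> of \<open>g\<close>, so iteration from \<open>0\<close> converges.  The bound on \<open>B * d\<^sup>2\<close> is what makes the product in the next lemma at least \<open>1 / 2\<close>.\<close>
lemma strong_stable_manifold:
  fixes l :: real
  assumes l: "0 < l" "l < 1"
  defines "\<mu> \<equiv> (1 + l) / 2"
  obtains B d h where "0 \<le> B" "0 < d" "d \<le> (1 - l) / 2" "B * d\<^sup>2 \<le> (1 - \<mu>\<^sup>2) / 4"
    "h holomorphic_on ball 0 d"
    "\<forall>z \<in> ball 0 d. norm (h z) \<le> B * (norm z)\<^sup>2"
    "\<forall>z \<in> ball 0 d. h (P_map l z) = h z - (h z)\<^sup>2 - z\<^sup>2"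
proof -
  have \<mu>: "0 < \<mu>" "\<mu> < 1" using l by (auto simp: \<mu>_def)
  have \<mu>2: "\<mu>\<^sup>2 < 1" using \<mu> by (simp add: power_less_one_iff abs_square_less_1)
  obtain \<rho> g where g: "0 < \<rho>" "g holomorphic_on ball 0 \<rho>" "g 0 = 0"
    "\<forall>v \<in> ball 0 \<rho>. g v - (g v)\<^sup>2 = v"
    and lip: "\<forall>v \<in> ball 0 \<rho>. \<forall>v' \<in> ball 0 \<rho>. \<mu> * norm (g v - g v') \<le> norm (v - v')"
    by (rule holomorphic_inverse_branch[OF \<mu>])
  \<comment> \<open>The solution of \<open>(\<mu>\<^sup>2 B + 1) / \<mu> = B\<close>: the bound \<open>B |z|\<^sup>2\<close> reproduces itself under
    the iteration.\<close>
  define B where "B = 1 / (\<mu> * (1 - \<mu>))"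
  have B: "B > 0" "\<mu>\<^sup>2 * B + 1 = \<mu> * B"
    using \<mu> by (auto simp: B_def field_simps power2_eq_square)
  have "\<exists>d. 0 < d \<and> d \<le> (1 - l) / 2 \<and> B * d\<^sup>2 < min ((1 - \<mu>\<^sup>2) / 4) \<rho>"
  proof -
    have "(\<lambda>n. B * (inverse (real (Suc n)))\<^sup>2) \<longlonglongrightarrow> B * 0\<^sup>2"
      by (intro tendsto_intros LIMSEQ_inverse_real_of_nat)
    then have "\<forall>\<^sub>F n in sequentially. B * (inverse (real (Suc n)))\<^sup>2 < min ((1 - \<mu>\<^sup>2) / 4) \<rho>"
      by (rule order_tendstoD) (use \<mu>2 g(1) in auto)
    moreover have "\<forall>\<^sub>F n in sequentially. inverse (real (Suc n)) < (1 - l) / 2"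
      by (rule order_tendstoD[OF LIMSEQ_inverse_real_of_nat]) (use l in auto)
    ultimately have "\<forall>\<^sub>F n in sequentially. inverse (real (Suc n)) < (1 - l) / 2 \<and>
        B * (inverse (real (Suc n)))\<^sup>2 < min ((1 - \<mu>\<^sup>2) / 4) \<rho>"
      by eventually_elim blast
    then obtain n where "inverse (real (Suc n)) < (1 - l) / 2 \<and>
        B * (inverse (real (Suc n)))\<^sup>2 < min ((1 - \<mu>\<^sup>2) / 4) \<rho>"
      using eventually_happens'[OF sequentially_bot] by blast
    then show ?thesis by (intro exI[of _ "inverse (real (Suc n))"]) auto
  qed
  then obtain d where d: "0 < d" "d \<le> (1 - l) / 2" "B * d\<^sup>2 < (1 - \<mu>\<^sup>2) / 4" "B * d\<^sup>2 < \<rho>"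
    by auto
  have P: "norm (P_map l z) \<le> \<mu> * norm z" "P_map l z \<in> ball 0 d" if "z \<in> ball 0 d" for z
  proof -
    show 1: "norm (P_map l z) \<le> \<mu> * norm z"
      unfolding \<mu>_def using that d by (intro P_map_contraction[OF l]) auto
    have "\<mu> * norm z \<le> 1 * norm z" using \<mu> by (intro mult_right_mono) auto
    then show "P_map l z \<in> ball 0 d" using 1 that by simp
  qed
  have P2: "(norm (P_map l z))\<^sup>2 \<le> \<mu>\<^sup>2 * (norm z)\<^sup>2" if "z \<in> ball 0 d" for z
    using power_mono[OF P(1)[OF that], of 2] by (simp add: power_mult_distrib)
  have arg: "norm (a + z\<^sup>2) \<le> \<mu> * B * (norm z)\<^sup>2" "a + z\<^sup>2 \<in> ball 0 \<rho>"
    if "z \<in> ball 0 d" "norm a \<le> B * (norm (P_map l z))\<^sup>2" for a z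
  proof -
    have "norm (a + z\<^sup>2) \<le> B * (norm (P_map l z))\<^sup>2 + (norm z)\<^sup>2"
      using norm_triangle_ineq[of a "z\<^sup>2"] that(2) by (simp add: norm_power)
    also have "\<dots> \<le> B * (\<mu>\<^sup>2 * (norm z)\<^sup>2) + (norm z)\<^sup>2"
      using P2[OF that(1)] B by simp
    also have "\<dots> = (\<mu>\<^sup>2 * B + 1) * (norm z)\<^sup>2" by (simp add: algebra_simps)
    finally show 1: "norm (a + z\<^sup>2) \<le> \<mu> * B * (norm z)\<^sup>2" unfolding B(2) .
    have "\<mu> * B * (norm z)\<^sup>2 \<le> 1 * B * d\<^sup>2"
      using \<mu> B that(1) by (intro mult_mono power_mono) auto
    then show "a + z\<^sup>2 \<in> ball 0 \<rho>" using 1 d(4) by simp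
  qed
  define H where "H = (\<lambda>k. ((\<lambda>h z. g (h (P_map l z) + z\<^sup>2)) ^^ k) (\<lambda>_. 0))"
  have H0: "H 0 = (\<lambda>_. 0)" and HSuc: "H (Suc k) = (\<lambda>z. g (H k (P_map l z) + z\<^sup>2))" for k
    by (simp_all add: H_def)
  have g_small: "norm (g v) \<le> B * r" if "v \<in> ball 0 \<rho>" "norm v \<le> \<mu> * B * r" for v r
  proof -
    have "\<mu> * norm (g v) \<le> norm v" using lip[rule_format, OF that(1), of 0] g(1,3) by simp
    then have "\<mu> * norm (g v) \<le> \<mu> * (B * r)" using that(2) by (simp add: mult.assoc)
    then show ?thesis using \<mu> by simp
  qed
  have H_bound: "norm (H k z) \<le> B * (norm z)\<^sup>2" if "z \<in> ball 0 d" for k z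
    using that
  proof (induction k arbitrary: z)
    case (Suc k)
    show ?case unfolding HSuc
      using arg[OF Suc.prems Suc.IH[OF P(2)[OF Suc.prems]]] by (intro g_small) auto
  qed (use B in \<open>simp add: H0\<close>)
  have H_hol: "H k holomorphic_on ball 0 d" for k
  proof (induction k)
    case (Suc k)
    have "P_map l holomorphic_on ball 0 d" unfolding P_map_def[abs_def] by (intro holomorphic_intros)
    then have "(H k \<circ> P_map l) holomorphic_on ball 0 d"
      by (rule holomorphic_on_compose_gen[OF _ Suc]) (use P in blast)
    then have "(\<lambda>z. H k (P_map l z) + z\<^sup>2) holomorphic_on ball 0 d"
      unfolding o_def by (intro holomorphic_intros)
    then have "(g \<circ> (\<lambda>z. H k (P_map l z) + z\<^sup>2)) holomorphic_on ball 0 d"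
      by (rule holomorphic_on_compose_gen[OF _ g(2)]) (use arg(2) H_bound P(2) in blast)
    then show ?case by (simp add: HSuc o_def)
  qed (simp add: H0)
  have H_diff: "norm (H (Suc k) z - H k z) \<le> B * \<mu> ^ k * (norm z)\<^sup>2" if "z \<in> ball 0 d" for k z
    using that
  proof (induction k arbitrary: z)
    case 0
    then show ?case using H_bound[OF 0, of 1] by (simp add: H0)
  next
    case (Suc k)
    let ?Q = "P_map l z"
    have Q: "?Q \<in> ball 0 d" by (rule P(2)[OF Suc.prems])
    have "\<mu> * norm (H (Suc (Suc k)) z - H (Suc k) z) \<le> norm (H (Suc k) ?Q - H k ?Q)"
      using lip[rule_format, OF arg(2)[OF Suc.prems H_bound[OF Q]] arg(2)[OF Suc.prems H_bound[OF Q]], of "Suc k" k]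
      by (simp add: HSuc[of "Suc k"] HSuc[of k, THEN fun_cong, of z])
    also have "\<dots> \<le> B * \<mu> ^ k * (norm ?Q)\<^sup>2" by (rule Suc.IH[OF Q])
    also have "\<dots> \<le> B * \<mu> ^ k * (\<mu>\<^sup>2 * (norm z)\<^sup>2)"
      using P2[OF Suc.prems] B \<mu> by (intro mult_left_mono) auto
    also have "\<dots> = \<mu> * (B * \<mu> ^ Suc k * (norm z)\<^sup>2)" by (simp add: power2_eq_square)
    finally show ?case using \<mu> by simp
  qed
  define h where "h = (\<lambda>z. \<Sum>k. H (Suc k) z - H k z)"
  have unif: "uniform_limit (ball 0 d) H h sequentially"
  proof -
    have "uniform_limit (ball 0 d) (\<lambda>n z. \<Sum>k<n. H (Suc k) z - H k z) h sequentially"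
      unfolding h_def
    proof (rule Weierstrass_m_test)
      show "norm (H (Suc n) z - H n z) \<le> B * d\<^sup>2 * \<mu> ^ n" if "z \<in> ball 0 d" for n z
      proof -
        have "B * \<mu> ^ n * (norm z)\<^sup>2 \<le> B * \<mu> ^ n * d\<^sup>2"
          using that B \<mu> by (intro mult_left_mono power_mono) auto
        then show ?thesis using H_diff[OF that, of n] by (simp add: mult_ac)
      qed
      show "summable (\<lambda>n. B * d\<^sup>2 * \<mu> ^ n)"
        using \<mu> by (intro summable_mult summable_geometric) auto
    qed
    moreover have "(\<Sum>k<n. H (Suc k) z - H k z) = H n z" for n z
      using sum_lessThan_telescope[of "\<lambda>k. H k z" n] by (simp add: H0)
    ultimately show ?thesis by simp
  qed
  have lim: "(\<lambda>k. H k z) \<longlonglongrightarrow> h z" if "z \<in> ball 0 d" for z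
    using tendsto_uniform_limitI[OF unif that] .
  show thesis
  proof (rule that[of B d h])
    show "h holomorphic_on ball 0 d"
    proof (rule holomorphic_uniform_sequence[OF open_ball H_hol])
      fix z :: complex assume "z \<in> ball 0 d"
      then obtain e where "e > 0" "cball z e \<subseteq> ball 0 d"
        using open_contains_cball_eq[OF open_ball] by blast
      then show "\<exists>e>0. cball z e \<subseteq> ball 0 d \<and> uniform_limit (cball z e) H h sequentially"
        using uniform_limit_on_subset[OF unif] by blast
    qed
    have bound: "norm (h z) \<le> B * (norm z)\<^sup>2" if z: "z \<in> ball 0 d" for z
      using Lim_norm_ubound[OF sequentially_bot lim[OF z]] H_bound[OF z] by (simp add: always_eventually)
    then show "\<forall>z \<in> ball 0 d. norm (h z) \<le> B * (norm z)\<^sup>2" by blast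
    show "\<forall>z \<in> ball 0 d. h (P_map l z) = h z - (h z)\<^sup>2 - z\<^sup>2"
    proof
      fix z :: complex assume z: "z \<in> ball 0 d"
      have Q: "P_map l z \<in> ball 0 d" by (rule P(2)[OF z])
      have in\<rho>: "h (P_map l z) + z\<^sup>2 \<in> ball 0 \<rho>" by (rule arg(2)[OF z bound[OF Q]])
      have "isCont g (h (P_map l z) + z\<^sup>2)"
        using continuous_on_eq_continuous_at[OF open_ball, of 0 \<rho> g]
          holomorphic_on_imp_continuous_on[OF g(2)] in\<rho> by blast
      then have "(\<lambda>k. g (H k (P_map l z) + z\<^sup>2)) \<longlonglongrightarrow> g (h (P_map l z) + z\<^sup>2)"
        by (rule isCont_tendsto_compose) (intro tendsto_intros lim Q)
      moreover have "(\<lambda>k. g (H k (P_map l z) + z\<^sup>2)) \<longlonglongrightarrow> h z"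
        using LIMSEQ_Suc[OF lim[OF z]] by (simp add: HSuc)
      ultimately have "h z = g (h (P_map l z) + z\<^sup>2)" using LIMSEQ_unique by blast
      then have "h z - (h z)\<^sup>2 = h (P_map l z) + z\<^sup>2" using g(4)[rule_format, OF in\<rho>] by simp
      then show "h (P_map l z) = h z - (h z)\<^sup>2 - z\<^sup>2" by (simp add: algebra_simps)
    qed
  qed (use B d in auto)
qed

text \<open>For fixed \<open>z\<close>, the derivative of the second coordinate of \<open>F\<^sup>n\<close> with respect to \<open>w\<close> is the
  product of the factors \<open>1 - 2 w\<^sub>i\<close> along the orbit.  On the graph of \<open>h\<close> the \<open>w\<^sub>i\<close> decay
  geometrically, and the product stays above \<open>1 / 2\<close>.  In the basin it has to tend to \<open>0\<close>, by Cauchy's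
  estimate, since \<open>F\<^sup>n\<close> converges to a constant uniformly on a neighbourhood.\<close>
lemma basin_avoids_strong_stable_manifold:
  fixes l :: real
  assumes l: "0 < l" "l < 1"
  defines "\<mu> \<equiv> (1 + l) / 2"
  assumes B: "0 \<le> B" and d: "0 < d" "d \<le> (1 - l) / 2" "B * d\<^sup>2 \<le> (1 - \<mu>\<^sup>2) / 4"
    and h_bound: "\<And>z. z \<in> ball 0 d \<Longrightarrow> norm (h z) \<le> B * (norm z)\<^sup>2"
    and h_eq: "\<And>z. z \<in> ball 0 d \<Longrightarrow> h (P_map l z) = h z - (h z)\<^sup>2 - z\<^sup>2"
    and x: "x \<in> attracting_basin (F_map l) (0, 0)" "fst x \<in> ball 0 d"
  shows "snd x \<noteq> h (fst x)"
proof
  assume on: "snd x = h (fst x)"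
  define z0 w0 where "z0 = fst x" and "w0 = snd x"
  have \<mu>: "0 < \<mu>" "\<mu> < 1" using l by (auto simp: \<mu>_def)
  have \<mu>2: "\<mu>\<^sup>2 < 1" using \<mu> by (simp add: power_less_one_iff abs_square_less_1)
  define W where "W = (\<lambda>n t. snd ((F_map l ^^ n) (z0, t)))"
  have W0: "W 0 = (\<lambda>t. t)" and WSuc: "W (Suc n) = (\<lambda>t. W n t - (W n t)\<^sup>2 - ((P_map l ^^ n) z0)\<^sup>2)" for n
    by (simp add: W_def) (simp add: W_def snd_F_map_Suc fun_eq_iff del: funpow.simps)
  define zs where "zs = (\<lambda>n. (P_map l ^^ n) z0)"
  have zs: "norm (zs n) \<le> \<mu> ^ n * d" "zs n \<in> ball 0 d" for n
  proof -
    have z0: "norm z0 < d" using x by (simp add: z0_def)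
    have 1: "norm (zs n) \<le> \<mu> ^ n * norm z0"
      unfolding zs_def \<mu>_def using z0 d by (intro P_map_iterate_bound[OF l]) auto
    have "\<mu> ^ n * norm z0 \<le> \<mu> ^ n * d" using z0 \<mu> by (intro mult_left_mono) auto
    then show "norm (zs n) \<le> \<mu> ^ n * d" using 1 by linarith
    have "\<mu> ^ n * norm z0 \<le> 1 * norm z0" using \<mu> by (intro mult_right_mono power_le_one) auto
    then show "zs n \<in> ball 0 d" using 1 z0 by simp
  qed
  have W_w0: "W n w0 = h (zs n)" for n
  proof (induction n)
    case 0
    then show ?case using on by (simp add: W0 zs_def z0_def w0_def)
  next
    case (Suc n)
    have "zs (Suc n) = P_map l (zs n)" by (simp add: zs_def)
    then show ?case using h_eq[OF zs(2)[of n]] Suc by (simp add: WSuc zs_def)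
  qed
  have W_deriv: "(W n has_field_derivative (\<Prod>i<n. 1 - 2 * W i t)) (at t)" for n t
  proof (induction n)
    case 0
    then show ?case by (simp add: W0)
  next
    case (Suc n)
    show ?case unfolding WSuc
      by (rule derivative_eq_intros Suc refl)+ (simp add: algebra_simps)
  qed
  have deriv_ge: "1 / 2 \<le> norm (deriv (W n) w0)" for n
  proof -
    define e where "e = (\<lambda>i. 2 * norm (h (zs i)))"
    have e: "e i \<le> 2 * (B * d\<^sup>2) * (\<mu>\<^sup>2) ^ i" for i
    proof -
      have "norm (h (zs i)) \<le> B * (norm (zs i))\<^sup>2" by (rule h_bound[OF zs(2)])
      also have "\<dots> \<le> B * (\<mu> ^ i * d)\<^sup>2" using zs(1)[of i] B by (intro mult_left_mono power_mono) auto
      finally show ?thesis by (simp add: e_def power_mult_distrib power_mult[symmetric] mult_ac)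
    qed
    have Bd: "0 \<le> B * d\<^sup>2" using B by simp
    have e01: "e i \<in> {0..1}" for i
    proof -
      have "2 * (B * d\<^sup>2) * (\<mu>\<^sup>2) ^ i \<le> 2 * (B * d\<^sup>2) * 1"
        using Bd \<mu>2 \<mu> by (intro mult_left_mono power_le_one) auto
      moreover have "0 \<le> \<mu>\<^sup>2" by simp
      ultimately have "e i \<le> 1" using e[of i] d(3) by argo
      then show ?thesis by (simp add: e_def)
    qed
    have "sum e {..<n} \<le> (\<Sum>i<n. 2 * (B * d\<^sup>2) * (\<mu>\<^sup>2) ^ i)" by (intro sum_mono e)
    also have "\<dots> = 2 * (B * d\<^sup>2) * ((1 - (\<mu>\<^sup>2) ^ n) / (1 - \<mu>\<^sup>2))"
      using \<mu>2 by (simp add: sum_distrib_left[symmetric] sum_gp_strict)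
    also have "\<dots> \<le> 2 * ((1 - \<mu>\<^sup>2) / 4) * (1 / (1 - \<mu>\<^sup>2))"
      using d(3) Bd \<mu>2 \<mu> by (intro mult_mono divide_right_mono) (auto simp: power_le_one)
    also have "\<dots> = 1 / 2" using \<mu>2 by simp
    finally have "1 / 2 \<le> 1 - sum e {..<n}" by simp
    also have "\<dots> \<le> (\<Prod>i<n. 1 - e i)" by (rule Weierstrass_prod_ineq) (rule e01)
    also have "\<dots> \<le> (\<Prod>i<n. norm (1 - 2 * W i w0))"
    proof (intro prod_mono conjI)
      fix i
      show "0 \<le> 1 - e i" using e01[of i] by simp
      show "1 - e i \<le> norm (1 - 2 * W i w0)"
        using norm_triangle_ineq2[of 1 "2 * W i w0"] by (simp add: e_def W_w0 norm_mult)
    qed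
    also have "\<dots> = norm (deriv (W n) w0)"
      using DERIV_imp_deriv[OF W_deriv[of n w0]] by (simp add: prod_norm)
    finally show ?thesis .
  qed
  obtain U where U: "open U" "x \<in> U" "uniform_limit U (\<lambda>n. F_map l ^^ n) (\<lambda>_. (0, 0)) sequentially"
    using x(1) by (auto simp: attracting_basin_def)
  have "(z0, w0) \<in> U" using U(2) by (simp add: z0_def w0_def)
  then obtain A V where AV: "open A" "open V" "(z0, w0) \<in> A \<times> V" "A \<times> V \<subseteq> U"
    by (rule open_prod_elim[OF U(1)])
  then obtain r where r: "r > 0" "cball w0 r \<subseteq> V"
    using open_contains_cball_eq[OF AV(2)] by auto
  have "\<forall>\<^sub>F n in sequentially. \<forall>y\<in>U. dist ((F_map l ^^ n) y) (0, 0) < r / 4"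
    by (rule uniform_limitD[OF U(3)]) (use r in simp)
  then obtain n where n: "\<forall>y\<in>U. dist ((F_map l ^^ n) y) (0, 0) < r / 4"
    using eventually_happens'[OF sequentially_bot] by blast
  have Wn: "norm (W n t) \<le> r / 4" if "t \<in> cball w0 r" for t
  proof -
    have "(z0, t) \<in> U" using that r AV by blast
    then have "norm ((F_map l ^^ n) (z0, t)) < r / 4" using n by (simp flip: zero_prod_def)
    then show ?thesis unfolding W_def
      using norm_snd_le[of "snd ((F_map l ^^ n) (z0, t))" "fst ((F_map l ^^ n) (z0, t))"] by simp
  qed
  have "norm ((deriv ^^ 1) (W n) w0) \<le> fact 1 * (r / 4) / r ^ 1"
  proof (rule Cauchy_inequality)
    have hol: "W n holomorphic_on S" for S
      using W_deriv holomorphic_on_open[of UNIV "W n"] by (meson holomorphic_on_subset open_UNIV subset_UNIV)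
    then show "W n holomorphic_on ball w0 r" "continuous_on (cball w0 r) (W n)"
      by (auto intro: holomorphic_on_imp_continuous_on)
    show "norm (W n t) \<le> r / 4" if "norm (w0 - t) = r" for t
      using that by (intro Wn) (simp add: dist_norm)
  qed (rule r)
  then have "norm (deriv (W n) w0) \<le> 1 / 4" using r by simp
  then show False using deriv_ge[of n] by simp
qed

section \<open>Divergence of the distance along an orbit\<close>

text \<open>Consider \<open>u = w - h z\<close> composed with \<open>F\<^sup>m\<close>.  Along a chain of length at most \<open>C\<close> that ends in \<open>y\<close>
  the function \<open>- ln |u / 5|\<close> is at most \<open>exp (\<kappa> C)\<close> times its value at \<open>y\<close>, with \<open>m\<close> and
  \<open>\<kappa>\<close> depending on \<open>C\<close> only, while it tends to infinity along the orbit of \<open>y\<close>.\<close>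
lemma kobayashi_dist_orbit_unbounded:
  assumes l: "0 < l" "l < 1" and y: "y \<in> attracting_basin (F_map l) (0, 0)"
  shows "\<exists>N. \<forall>n\<ge>N. ereal C \<le> kobayashi_dist (attracting_basin (F_map l) (0, 0)) ((F_map l ^^ n) y) y"
proof -
  define \<Omega> where "\<Omega> = attracting_basin (F_map l) (0, 0)"
  obtain B d h where B: "0 \<le> B" and d: "0 < d" "d \<le> (1 - l) / 2" "B * d\<^sup>2 \<le> (1 - ((1 + l) / 2)\<^sup>2) / 4"
    and h_hol: "h holomorphic_on ball 0 d"
    and h_bound: "\<forall>z \<in> ball 0 d. norm (h z) \<le> B * (norm z)\<^sup>2"
    and h_eq: "\<forall>z \<in> ball 0 d. h (P_map l z) = h z - (h z)\<^sup>2 - z\<^sup>2"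
    by (rule strong_stable_manifold[OF l])
  \<comment> \<open>Two marked points of a disc in a chain of length at most \<open>C\<close> have pseudohyperbolic distance at
    most \<open>\<tau>\<close>, so they stay well inside the discs of radius \<open>r\<close>.\<close>
  define \<tau> where "\<tau> = tanh C"
  define r where "r = (1 + \<tau>) / 2"
  have \<tau>: "- 1 < \<tau>" "\<tau> < 1" by (auto simp: \<tau>_def tanh_real_lt_1 tanh_real_gt_neg1)
  have r: "0 < r" "r < 1" "\<tau> < r" using \<tau> by (auto simp: r_def)
  have fst_basin: "fst x \<in> P_basin l" if "x \<in> \<Omega>" for x
    using tendsto_fst[OF attracting_basin_tendsto[OF that[unfolded \<Omega>_def]]]
    by (simp add: P_basin_def fst_F_map_iterate)
  have "P_basin l \<subseteq> cball 0 2"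
    using P_map_iterates_to_0_bound[OF l] by (auto simp: P_basin_def)
  then obtain K where K: "compact K" "K \<subseteq> P_basin l"
    and K_chain: "\<forall>n \<phi> a b c. c n = fst y \<and> (\<forall>i<n. \<phi> i holomorphic_on ball 0 1 \<and>
        \<phi> i ` ball 0 1 \<subseteq> P_basin l \<and> a i \<in> ball 0 1 \<and> b i \<in> ball 0 1 \<and>
        \<phi> i (a i) = c i \<and> \<phi> i (b i) = c (Suc i)) \<and>
        (\<Sum>i<n. poincare_dist (a i) (b i)) \<le> C \<longrightarrow>
      (\<forall>i<n. \<phi> i ` pseudohyperbolic_disc (b i) r \<subseteq> K)"
    by (rule short_chain_stays_in_compact[OF open_P_basin[OF l] _ _ r(1,2), of "fst y" C])
       (use fst_basin y in \<open>auto simp: \<Omega>_def\<close>)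
  obtain m where m: "\<And>z. z \<in> K \<Longrightarrow> norm ((P_map l ^^ m) z) < d"
    using P_map_iterate_uniformly_small_on_compact[OF l d(1,2) K] by blast
  define u where "u = (\<lambda>x. snd ((F_map l ^^ m) x) - h (fst ((F_map l ^^ m) x)))"
  have u: "u x \<noteq> 0" "norm (u x / 5) < 1" if x: "x \<in> \<Omega>" "fst x \<in> K" for x
  proof -
    let ?x = "(F_map l ^^ m) x"
    have in\<Omega>: "?x \<in> attracting_basin (F_map l) (0, 0)"
      using x(1) by (simp add: \<Omega>_def F_map_iterate_mem_basin_iff)
    have in_ball: "fst ?x \<in> ball 0 d" using m[OF x(2)] by (simp add: fst_F_map_iterate)
    have "snd ?x \<noteq> h (fst ?x)"
      by (rule basin_avoids_strong_stable_manifold[OF l B d _ _ in\<Omega> in_ball])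
         (use h_bound h_eq in auto)
    then show "u x \<noteq> 0" by (simp add: u_def)
    have "norm (h (fst ?x)) \<le> B * (norm (fst ?x))\<^sup>2" using h_bound in_ball by blast
    also have "\<dots> \<le> B * d\<^sup>2" using in_ball B by (intro mult_left_mono power_mono) auto
    also have "\<dots> \<le> 1 / 4"
      by (rule order_trans[OF d(3)]) (intro divide_right_mono, auto)
    finally have "norm (u x) \<le> 4 + 1 / 4"
      using norm_triangle_ineq4[of "snd ?x" "h (fst ?x)"] basin_bounds(2)[OF l in\<Omega>]
      unfolding u_def by linarith
    then show "norm (u x / 5) < 1" by (simp add: norm_divide)
  qed
  have u_lim: "(\<lambda>n. u ((F_map l ^^ n) y)) \<longlonglongrightarrow> 0"
  proof -
    have lim: "(\<lambda>n. (F_map l ^^ (n + m)) y) \<longlonglongrightarrow> (0, 0)"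
      by (rule LIMSEQ_ignore_initial_segment[OF attracting_basin_tendsto[OF y]])
    have eq: "(F_map l ^^ m) ((F_map l ^^ n) y) = (F_map l ^^ (n + m)) y" for n
      using funpow_add[of m n "F_map l"] by (simp add: add.commute)
    have "isCont h 0"
      using continuous_on_eq_continuous_at[OF open_ball, of 0 d h]
        holomorphic_on_imp_continuous_on[OF h_hol] d(1) by simp
    then have "(\<lambda>n. h (fst ((F_map l ^^ (n + m)) y))) \<longlonglongrightarrow> h 0"
      by (rule isCont_tendsto_compose) (use tendsto_fst[OF lim] in simp)
    moreover have "h 0 = 0" using h_bound[rule_format, of 0] d(1) by simp
    moreover have "(\<lambda>n. snd ((F_map l ^^ (n + m)) y)) \<longlonglongrightarrow> 0" using tendsto_snd[OF lim] by simp
    ultimately have "(\<lambda>n. snd ((F_map l ^^ (n + m)) y) - h (fst ((F_map l ^^ (n + m)) y))) \<longlonglongrightarrow> 0 - h 0"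
      by (intro tendsto_diff)
    then show ?thesis using \<open>h 0 = 0\<close> by (simp add: u_def eq)
  qed
  \<comment> \<open>With this constant \<open>(r + t) / (r - t) \<le> exp (\<kappa> \<delta>)\<close> whenever \<open>t = tanh \<delta> \<le> \<tau>\<close>.\<close>
  define \<kappa> where "\<kappa> = 4 / (r - \<tau>)"
  have \<kappa>: "0 \<le> \<kappa>" using r by (simp add: \<kappa>_def)
  define v where "v = (\<lambda>x. - ln (norm (u x / 5)))"
  have "\<forall>\<^sub>F n in sequentially. dist (u ((F_map l ^^ n) y)) 0 < 5 * exp (- (exp (\<kappa> * C) * v y))"
    by (rule tendstoD[OF u_lim]) simp
  then obtain N where N: "\<And>n. N \<le> n \<Longrightarrow> norm (u ((F_map l ^^ n) y)) < 5 * exp (- (exp (\<kappa> * C) * v y))"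
    by (auto simp: eventually_sequentially)
  have "ereal C \<le> kobayashi_dist \<Omega> ((F_map l ^^ n) y) y" if "N \<le> n" for n
    unfolding kobayashi_dist_def
  proof (rule Inf_greatest, elim CollectE exE conjE)
    fix s and k :: nat and f a b p
    assume s: "s = ereal (\<Sum>i<k. poincare_dist (a i) (b i))"
      and k: "0 < k" and p0: "p 0 = (F_map l ^^ n) y" and pk: "p k = y"
      and chain: "\<forall>i<k. f i \<in> holomorphic_discs \<Omega> \<and> a i \<in> ball 0 1 \<and> b i \<in> ball 0 1 \<and>
        f i (a i) = p i \<and> f i (b i) = p (Suc i)"
    show "ereal C \<le> s"

    proof (rule ccontr)
      assume "\<not> ?thesis"
      then have short: "(\<Sum>i<k. poincare_dist (a i) (b i)) \<le> C" by (simp add: s)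
      have disc: "(\<lambda>t. fst (f i t)) holomorphic_on ball 0 1" "(\<lambda>t. snd (f i t)) holomorphic_on ball 0 1"
          "\<And>t. t \<in> ball 0 1 \<Longrightarrow> f i t \<in> \<Omega>"
        and ab: "a i \<in> ball 0 1" "b i \<in> ball 0 1" "f i (a i) = p i" "f i (b i) = p (Suc i)"
        if "i < k" for i
        using chain that unfolding holomorphic_discs_def by blast+
      have inK: "fst (f i t) \<in> K" if "i < k" "t \<in> pseudohyperbolic_disc (b i) r" for i t
      proof -
        have img: "(\<lambda>t. fst (f i t)) ` ball 0 1 \<subseteq> P_basin l" if "i < k" for i
          using disc(3)[OF that] fst_basin by blast
        have "(\<lambda>t. fst (f i t)) ` pseudohyperbolic_disc (b i) r \<subseteq> K"
        proof (rule K_chain[rule_format, of "\<lambda>i. fst (p i)" k "\<lambda>i t. fst (f i t)" a b i])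
          show "fst (p k) = fst y \<and> (\<forall>i<k. (\<lambda>t. fst (f i t)) holomorphic_on ball 0 1 \<and>
              (\<lambda>t. fst (f i t)) ` ball 0 1 \<subseteq> P_basin l \<and> a i \<in> ball 0 1 \<and> b i \<in> ball 0 1 \<and>
              fst (f i (a i)) = fst (p i) \<and> fst (f i (b i)) = fst (p (Suc i))) \<and>
              (\<Sum>i<k. poincare_dist (a i) (b i)) \<le> C"
            using pk short disc(1) img ab by simp
        qed (rule that(1))
        then show ?thesis using that by blast
      qed
      have pd_ball: "pseudohyperbolic_disc (b i) r \<subseteq> ball 0 1" for i
        by (auto simp: pseudohyperbolic_disc_def)
      have step: "v (p i) \<le> exp (\<kappa> * poincare_dist (a i) (b i)) * v (p (Suc i)) \<and>
          u (p i) \<noteq> 0 \<and> 0 \<le> v (p (Suc i))" if i: "i < k" for i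
      proof -
        let ?D = "pseudohyperbolic_disc (b i) r"
        define t where "t = norm (Moebius_function 0 (b i) (a i))"
        note pd = poincare_dist_properties[OF ab(1,2)[OF i], folded t_def]
        have "poincare_dist (a i) (b i) \<le> (\<Sum>i<k. poincare_dist (a i) (b i))"
          using i poincare_dist_nonneg[OF ab(1,2)] by (intro member_le_sum) auto
        then have "poincare_dist (a i) (b i) \<le> C" using short by linarith
        then have t\<tau>: "t \<le> \<tau>" unfolding pd(3) \<tau>_def by simp
        have aD: "a i \<in> ?D" using ab(1)[OF i] t\<tau> r(3) by (simp add: pseudohyperbolic_disc_def t_def)
        have bD: "b i \<in> ?D"
          using ab(2)[OF i] r(1) by (simp add: pseudohyperbolic_disc_def Moebius_function_eq_zero)
        have u_disc: "u (f i x) \<noteq> 0" "norm (u (f i x) / 5) < 1" if "x \<in> ?D" for x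
          using u[OF disc(3)[OF i] inK[OF i that]] that pd_ball by blast+
        define g where "g = (\<lambda>x. u (f i x) / 5)"
        have Fhol: "(\<lambda>x. fst ((F_map l ^^ m) (f i x))) holomorphic_on ?D"
            "(\<lambda>x. snd ((F_map l ^^ m) (f i x))) holomorphic_on ?D"
          using F_map_iterate_holomorphic[where f = "f i" and S = "?D" and l = l and n = m]
            holomorphic_on_subset[OF disc(1)[OF i] pd_ball] holomorphic_on_subset[OF disc(2)[OF i] pd_ball]
          by auto
        have "(h \<circ> (\<lambda>x. fst ((F_map l ^^ m) (f i x)))) holomorphic_on ?D"
          by (rule holomorphic_on_compose_gen[OF Fhol(1) h_hol])
             (use m inK[OF i] in \<open>auto simp: fst_F_map_iterate\<close>)
        then have g_hol: "g holomorphic_on ?D"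
          unfolding g_def u_def o_def by (intro holomorphic_intros Fhol) auto
        have "- ln (norm (g (a i))) \<le> (r + t) / (r - t) * - ln (norm (g (b i)))"
          unfolding t_def
          by (rule harnack_pseudohyperbolic_disc[OF ab(2)[OF i] r(1) _ g_hol _ aD])
             (use u_disc r in \<open>auto simp: g_def\<close>)
        then have 1: "v (p i) \<le> (r + t) / (r - t) * v (p (Suc i))"
          by (simp add: g_def v_def ab(3,4)[OF i])
        have v0: "0 \<le> v (p (Suc i))"
          using u_disc[OF bD] by (simp add: v_def ab(4)[OF i])
        have "(r + t) / (r - t) = 1 + 2 * t / (r - t)" using t\<tau> r by (simp add: field_simps)
        also have "\<dots> \<le> 1 + 2 * t / (r - \<tau>)"
          using t\<tau> r pd(1) by (intro add_left_mono divide_left_mono) auto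
        also have "\<dots> \<le> 1 + \<kappa> * poincare_dist (a i) (b i)"
        proof -
          have "2 * t / (r - \<tau>) \<le> 2 * (2 * poincare_dist (a i) (b i)) / (r - \<tau>)"
            using pd(5) r by (intro divide_right_mono mult_left_mono) auto
          then show ?thesis by (simp add: \<kappa>_def)
        qed
        also have "\<dots> \<le> exp (\<kappa> * poincare_dist (a i) (b i))" by (rule exp_ge_add_one_self)
        finally have "(r + t) / (r - t) * v (p (Suc i)) \<le>
            exp (\<kappa> * poincare_dist (a i) (b i)) * v (p (Suc i))"
          using v0 by (rule mult_right_mono)
        then show ?thesis using 1 v0 u_disc(1)[OF aD] ab(3)[OF i] by auto
      qed
      have vk: "0 \<le> v (p k)" using step[of "k - 1"] k by simp
      have "v (p 0) \<le> exp (\<kappa> * C) * v (p k)"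
        by (rule chain_growth_total[of k "\<lambda>i. v (p i)" \<kappa> "\<lambda>i. poincare_dist (a i) (b i)"])
           (use step poincare_dist_nonneg ab short \<kappa> vk in auto)
      then have le: "v (p 0) \<le> exp (\<kappa> * C) * v y" using pk by simp
      have "0 < norm (u (p 0))" using step[OF k] by simp
      moreover have "norm (u (p 0) / 5) < exp (- (exp (\<kappa> * C) * v y))"
        using N[OF that] p0 by (simp add: norm_divide)
      ultimately have "ln (norm (u (p 0) / 5)) < - (exp (\<kappa> * C) * v y)"
        using ln_less_cancel_iff[of "norm (u (p 0) / 5)" "exp (- (exp (\<kappa> * C) * v y))"]
        by (simp add: norm_divide)
      then show False using le by (simp add: v_def)
    qed
  qed
  then show ?thesis unfolding \<Omega>_def by blast
qed

section \<open>Preimages of a point near the fixed point\<close>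

theorem theorem4p3:
  fixes l :: real
  assumes "0 < l" and "l < 1"
  shows "\<exists>\<epsilon>\<^sub>0>0. \<forall>\<epsilon>::real. 0 < \<epsilon> \<and> \<epsilon> < \<epsilon>\<^sub>0 \<longrightarrow>
    (\<forall>\<Omega>\<^sub>\<alpha> \<in> components (attracting_basin (F_map l) (0, 0)).
       \<forall>C::real. C > 0 \<longrightarrow>
         (\<exists>p \<in> \<Omega>\<^sub>\<alpha>.
            \<forall>q \<in> iterated_preimages (F_map l) (complex_of_real \<epsilon>, complex_of_real \<epsilon>) \<inter> \<Omega>\<^sub>\<alpha>.
              kobayashi_dist \<Omega>\<^sub>\<alpha> p q \<ge> ereal C))"
proof -
  note l = assms
  let ?\<Omega> = "attracting_basin (F_map l) (0, 0)"
  obtain \<epsilon>0 where \<epsilon>0: "\<epsilon>0 > 0" and seg: "\<And>\<epsilon>. 0 < \<epsilon> \<Longrightarrow> \<epsilon> < \<epsilon>0 \<Longrightarrow>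
    closed_segment (complex_of_real \<epsilon>, complex_of_real \<epsilon>)
      (F_map l (complex_of_real \<epsilon>, complex_of_real \<epsilon>)) \<subseteq> ?\<Omega>"
    using segment_in_basin[OF l] by blast
  have "\<exists>p \<in> A. \<forall>q \<in> iterated_preimages (F_map l) (complex_of_real \<epsilon>, complex_of_real \<epsilon>) \<inter> A.
      kobayashi_dist A p q \<ge> ereal C"
    if \<epsilon>: "0 < \<epsilon>" "\<epsilon> < \<epsilon>0" and A: "A \<in> components ?\<Omega>" for \<epsilon> C A
  proof -
    define q0 where "q0 = (complex_of_real \<epsilon>, complex_of_real \<epsilon>)"
    show ?thesis
    proof (cases "\<exists>j. \<exists>q\<in>A. (F_map l ^^ j) q = q0")
      case False
      then have "iterated_preimages (F_map l) q0 \<inter> A = {}" by (auto simp: iterated_preimages_def)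
      then show ?thesis using in_components_nonempty[OF A] unfolding q0_def by blast
    next
      case True
      define j where "j = (LEAST j. \<exists>q\<in>A. (F_map l ^^ j) q = q0)"
      have j: "\<exists>q\<in>A. (F_map l ^^ j) q = q0" unfolding j_def using True by (rule LeastI_ex)
      have j_le: "j \<le> k" if "q \<in> A" "(F_map l ^^ k) q = q0" for q k
        unfolding j_def using that by (intro Least_le) blast
      \<comment> \<open>\<open>C0\<close> is a fixed component, and it contains the forward orbit of \<open>q0\<close>.\<close>
      define C0 where "C0 = (F_map l ^^ j) ` A"
      have C0: "C0 \<in> components ?\<Omega>" unfolding C0_def by (rule F_map_iterate_component[OF l A])
      have q0: "q0 \<in> C0" using j unfolding C0_def by (auto simp: image_iff)
      have "closed_segment q0 (F_map l q0) \<subseteq> C0"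
        using q0 by (intro components_maximal[OF C0 connected_segment(1)])
          (use seg[OF \<epsilon>] in \<open>auto simp: q0_def\<close>)
      then have Fq0: "F_map l q0 \<in> C0" by auto
      have "F_map l ` C0 \<in> components ?\<Omega>" using F_map_iterate_component[OF l C0, of 1] by simp
      then have "F_map l ` C0 = C0" using components_eq[OF _ C0] q0 Fq0 by blast
      then have orbit: "(F_map l ^^ n) q0 \<in> C0" for n
        by (induction n) (use q0 in auto)
      have "q0 \<in> ?\<Omega>" using q0 in_components_subset[OF C0] by blast
      then obtain N where N: "\<And>n. N \<le> n \<Longrightarrow> ereal C \<le> kobayashi_dist ?\<Omega> ((F_map l ^^ n) q0) q0"
        using kobayashi_dist_orbit_unbounded[OF l] by metis
      obtain p where p: "p \<in> A" "(F_map l ^^ j) p = (F_map l ^^ N) q0"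
        using orbit[of N] unfolding C0_def by (metis imageE)
      have "ereal C \<le> kobayashi_dist A p q" if q: "q \<in> iterated_preimages (F_map l) q0 \<inter> A" for q
      proof -
        obtain k where k: "(F_map l ^^ k) q = q0" using q by (auto simp: iterated_preimages_def)
        have "j \<le> k" using j_le[OF _ k] q by blast
        then have "(F_map l ^^ k) p = (F_map l ^^ (k - j)) ((F_map l ^^ j) p)"
          using funpow_add[of "k - j" j "F_map l"] by simp
        also have "\<dots> = (F_map l ^^ (k - j + N)) q0"
          unfolding p(2) funpow_add o_apply ..
        finally have "ereal C \<le> kobayashi_dist ?\<Omega> ((F_map l ^^ k) p) ((F_map l ^^ k) q)"
          using N[of "k - j + N"] k by simp
        also have "\<dots> \<le> kobayashi_dist A p q"
        proof (rule kobayashi_dist_decreasing)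
          fix f assume "f \<in> holomorphic_discs A"
          moreover have "(F_map l ^^ k) ` A \<subseteq> ?\<Omega>"
            using in_components_subset[OF A] by (auto simp: F_map_iterate_mem_basin_iff)
          ultimately show "(F_map l ^^ k) \<circ> f \<in> holomorphic_discs ?\<Omega>"
            by (rule F_map_iterate_holomorphic_discs)
        qed
        finally show ?thesis .
      qed
      then show ?thesis using p(1) unfolding q0_def by blast
    qed
  qed
  then show ?thesis using \<epsilon>0 by blast
qed

end
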